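(* Let $\mathbf K$ be an algebraically closed field and $X\subset\mathbf P^N$ a projective toric variety over $\mathbf K$ of dimension $n$. Then $$\omega_i(X;(\mathbf P^N)^\circ)=\tfrac12\,\mu_i(\Gamma_X;\|\cdot\|_1)\qquad\text{for } i=1,\dots,N-n.$$
   Context: $(\mathbf P^N)^\circ:=\mathbf P^N\setminus\{x_0\cdots x_N=0\}$. A projective toric variety $X\subset\mathbf P^N$ is the Zariski closure $X_{\mathcal A,\alpha}$ of the image of a monomial map $(\mathbf K^\times)^n\to\mathbf P^N$, $s\mapsto(\alpha_0s^{a_0}:\cdots:\alpha_Ns^{a_N})$, with $\mathcal A=(a_0,\dots,a_N)\in(\mathbf Z^n)^{N+1}$ and $\alpha\in(\mathbf K^\times)^{N+1}$ (all $\alpha_i\neq0$); one chooses $\mathcal A$ such that the differences of the $a_i$ generate $\mathbf Z^n$, so $\dim X=n$. The associated $\mathbf Z$-module is $$\Gamma_X:=\{\lambda\in\mathbf Z^{N+1}:\ \textstyle\sum_i\lambda_i=0,\ \sum_i\lambda_ia_i=0\},$$ a saturated submodule of $\mathbf Z^{N+1}$ of rank $N-n$ depending only on $X$. For a projective variety $X$ of dimension $n$ with homogeneous ideal $I(X)\subset\mathbf K[x_0,\dots,x_N]$, an open set $U\subset\mathbf P^N$ and $1\le i\le N-n$: $\omega_i(X;U):=\min\{D\in\mathbf N:\dim(Z(f:f\in I(X)_D)\cap U)\le N-i\}$, with $I(X)_D$ the degree $D$ part of $I(X)$ and $Z(\cdot)$ the common zero set. $\|v\|_1=\sum_{i=0}^N|v_i|$,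 and $\mu_i(\Gamma;\|\cdot\|_1)$ is the $i$-th successive minimum: the smallest $\nu\ge0$ such that $\Gamma$ contains $i$ linearly independent vectors of $\ell^1$-norm at most $\nu$. *)

theory Defs
  imports
    "HOL-Analysis.Analysis"
    "HOL-Library.Poly_Mapping"
    "HOL-Computational_Algebra.Polynomial"
begin

section \<open>Polynomials in x_0, ..., x_N\<close>

text \<open>Multivariate polynomials are finitely supported maps from exponent vectors to coefficients;
  the ring structure is the convolution product of \<^theory>\<open>HOL-Library.Poly_Mapping\<close>.\<close>

type_synonym 'k mpol = "(nat \<Rightarrow>\<^sub>0 nat) \<Rightarrow>\<^sub>0 'k"

definition monom_eval :: "(nat \<Rightarrow> 'k::comm_semiring_1) \<Rightarrow> (nat \<Rightarrow>\<^sub>0 nat) \<Rightarrow> 'k" where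
  "monom_eval x m = (\<Prod>j\<in>Poly_Mapping.keys m. x j ^ Poly_Mapping.lookup m j)"

definition mpol_eval :: "'k::comm_semiring_1 mpol \<Rightarrow> (nat \<Rightarrow> 'k) \<Rightarrow> 'k" where
  "mpol_eval f x = (\<Sum>m\<in>Poly_Mapping.keys f. Poly_Mapping.lookup f m * monom_eval x m)"

definition poly_ring :: "nat \<Rightarrow> 'k::zero mpol set" where
  "poly_ring N = {f. \<forall>m\<in>Poly_Mapping.keys f. Poly_Mapping.keys m \<subseteq> {..N}}"

definition forms :: "nat \<Rightarrow> nat \<Rightarrow> 'k::zero mpol set" where
  "forms N D = {f \<in> poly_ring N. \<forall>m\<in>Poly_Mapping.keys f.
     (\<Sum>j\<in>Poly_Mapping.keys m. Poly_Mapping.lookup m j) = D}"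

section \<open>Projective space with its Zariski topology\<close>

text \<open>A vector of \<open>K^(N+1)\<close> is a function on the naturals that vanishes beyond index \<open>N\<close>.
  A point of projective space is the set of all its homogeneous coordinate vectors.\<close>

type_synonym 'k ppoint = "(nat \<Rightarrow> 'k) set"

definition hom_coords :: "nat \<Rightarrow> (nat \<Rightarrow> 'k::field) set" where
  "hom_coords N = {x. (\<forall>j>N. x j = 0) \<and> (\<exists>j\<le>N. x j \<noteq> 0)}"

definition pt :: "(nat \<Rightarrow> 'k::field) \<Rightarrow> 'k ppoint" where
  "pt x = {y. \<exists>c. c \<noteq> 0 \<and> y = (\<lambda>j. c * x j)}"

definition proj_space :: "nat \<Rightarrow> 'k::field ppoint set" where
  "proj_space N = pt ` hom_coords N"

definition proj_zeros :: "nat \<Rightarrow> 'k::field mpol set \<Rightarrow> 'k ppoint set" where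
  "proj_zeros N S = {P \<in> proj_space N. \<forall>f\<in>S. \<forall>x\<in>P. mpol_eval f x = 0}"

definition proj_torus :: "nat \<Rightarrow> 'k::field ppoint set" where
  "proj_torus N = proj_space N - {P \<in> proj_space N. \<forall>x\<in>P. (\<Prod>j\<le>N. x j) = 0}"

definition zariski_open :: "nat \<Rightarrow> 'k::field ppoint set \<Rightarrow> bool" where
  "zariski_open N U \<longleftrightarrow> (\<exists>S \<subseteq> (\<Union>D. forms N D). U = proj_space N - proj_zeros N S)"

definition zariski :: "nat \<Rightarrow> 'k::field ppoint topology" where
  "zariski N = topology (zariski_open N)"

subsection \<open>The Zariski topology is a topology\<close>

lemma monom_eval_superset:
  assumes "finite A" "Poly_Mapping.keys m \<subseteq> A"
  shows "monom_eval x m = (\<Prod>j\<in>A. x j ^ Poly_Mapping.lookup m j)"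
  unfolding monom_eval_def
  by (rule prod.mono_neutral_left) (use assms in \<open>auto simp: in_keys_iff\<close>)

lemma monom_eval_add: "monom_eval x (m + m') = monom_eval x m * monom_eval x m'"
proof -
  let ?A = "Poly_Mapping.keys m \<union> Poly_Mapping.keys m'"
  have "monom_eval x (m + m') = (\<Prod>j\<in>?A. x j ^ Poly_Mapping.lookup (m + m') j)"
    by (rule monom_eval_superset) (auto simp: Poly_Mapping.keys_add)
  moreover have "monom_eval x m = (\<Prod>j\<in>?A. x j ^ Poly_Mapping.lookup m j)"
    by (rule monom_eval_superset) auto
  moreover have "monom_eval x m' = (\<Prod>j\<in>?A. x j ^ Poly_Mapping.lookup m' j)"
    by (rule monom_eval_superset) auto
  ultimately show ?thesis
    by (simp add: lookup_add power_add prod.distrib)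
qed

lemma mpol_eval_superset:
  assumes "finite A" "Poly_Mapping.keys f \<subseteq> A"
  shows "mpol_eval f x = (\<Sum>m\<in>A. Poly_Mapping.lookup f m * monom_eval x m)"
  unfolding mpol_eval_def
  by (rule sum.mono_neutral_left) (use assms in \<open>auto simp: in_keys_iff\<close>)

lemma mpol_eval_add: "mpol_eval (f + g) x = mpol_eval f x + mpol_eval g x"
proof -
  let ?A = "Poly_Mapping.keys f \<union> Poly_Mapping.keys g"
  have "mpol_eval (f + g) x = (\<Sum>m\<in>?A. Poly_Mapping.lookup (f + g) m * monom_eval x m)"
    by (rule mpol_eval_superset) (auto simp: Poly_Mapping.keys_add)
  moreover have "mpol_eval f x = (\<Sum>m\<in>?A. Poly_Mapping.lookup f m * monom_eval x m)"
    by (rule mpol_eval_superset) auto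
  moreover have "mpol_eval g x = (\<Sum>m\<in>?A. Poly_Mapping.lookup g m * monom_eval x m)"
    by (rule mpol_eval_superset) auto
  ultimately show ?thesis
    by (simp add: lookup_add distrib_right sum.distrib)
qed

lemma mpol_eval_zero [simp]: "mpol_eval 0 x = 0"
  by (simp add: mpol_eval_def)

lemma mpol_eval_sum: "mpol_eval (sum F A) x = (\<Sum>a\<in>A. mpol_eval (F a) x)"
  by (induction A rule: infinite_finite_induct) (auto simp: mpol_eval_add)

lemma mpol_eval_single: "mpol_eval (Poly_Mapping.single m c) x = c * monom_eval x m"
  using mpol_eval_superset[of "{m}" "Poly_Mapping.single m c" x] by simp

lemma mpol_decomp:
  "f = (\<Sum>m\<in>Poly_Mapping.keys f. Poly_Mapping.single m (Poly_Mapping.lookup f m))"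
  by (rule poly_mapping_eqI)
    (auto simp: lookup_sum lookup_single when_def in_keys_iff)

lemma mpol_eval_mult: "mpol_eval (f * g) x = mpol_eval f x * mpol_eval g x"
proof -
  have "f * g =
      (\<Sum>m\<in>Poly_Mapping.keys f. Poly_Mapping.single m (Poly_Mapping.lookup f m)) *
      (\<Sum>m'\<in>Poly_Mapping.keys g. Poly_Mapping.single m' (Poly_Mapping.lookup g m'))"
    using mpol_decomp[of f] mpol_decomp[of g] by (rule arg_cong2)
  also have "\<dots> = (\<Sum>m\<in>Poly_Mapping.keys f. \<Sum>m'\<in>Poly_Mapping.keys g.
      Poly_Mapping.single (m + m') (Poly_Mapping.lookup f m * Poly_Mapping.lookup g m'))"
    by (simp only: sum_product mult_single)
  finally have "f * g = (\<Sum>m\<in>Poly_Mapping.keys f. \<Sum>m'\<in>Poly_Mapping.keys g.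
      Poly_Mapping.single (m + m') (Poly_Mapping.lookup f m * Poly_Mapping.lookup g m'))" .
  then have "mpol_eval (f * g) x = (\<Sum>m\<in>Poly_Mapping.keys f. \<Sum>m'\<in>Poly_Mapping.keys g.
      (Poly_Mapping.lookup f m * monom_eval x m) * (Poly_Mapping.lookup g m' * monom_eval x m'))"
    by (simp add: mpol_eval_sum mpol_eval_single monom_eval_add mult_ac)
  then show ?thesis
    by (simp add: mpol_eval_def sum_product)
qed

lemma mpol_eval_scale:
  assumes "f \<in> forms N D"
  shows "mpol_eval f (\<lambda>j. c * x j) = c ^ D * mpol_eval f x"
proof -
  have "monom_eval (\<lambda>j. c * x j) m = c ^ D * monom_eval x m" if "m \<in> Poly_Mapping.keys f" for m
    using assms that
    by (auto simp: forms_def monom_eval_def power_mult_distrib prod.distrib power_sum)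
  then show ?thesis
    by (simp add: mpol_eval_def sum_distrib_left mult_ac)
qed

lemma keys_add_nat:
  "Poly_Mapping.keys (m + m') = Poly_Mapping.keys m \<union> Poly_Mapping.keys (m' :: nat \<Rightarrow>\<^sub>0 nat)"
  by (auto simp: in_keys_iff lookup_add)

lemma degree_add_nat:
  "(\<Sum>j\<in>Poly_Mapping.keys (m + m'). Poly_Mapping.lookup (m + m') j) =
   (\<Sum>j\<in>Poly_Mapping.keys m. Poly_Mapping.lookup m j) +
   (\<Sum>j\<in>Poly_Mapping.keys m'. Poly_Mapping.lookup (m' :: nat \<Rightarrow>\<^sub>0 nat) j)"
proof -
  let ?A = "Poly_Mapping.keys m \<union> Poly_Mapping.keys m'"
  have "(\<Sum>j\<in>Poly_Mapping.keys m. Poly_Mapping.lookup m j) = (\<Sum>j\<in>?A. Poly_Mapping.lookup m j)"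
    by (rule sum.mono_neutral_left) (auto simp: in_keys_iff)
  moreover have
    "(\<Sum>j\<in>Poly_Mapping.keys m'. Poly_Mapping.lookup m' j) = (\<Sum>j\<in>?A. Poly_Mapping.lookup m' j)"
    by (rule sum.mono_neutral_left) (auto simp: in_keys_iff)
  ultimately show ?thesis
    by (simp add: keys_add_nat lookup_add sum.distrib)
qed

lemma forms_mult:
  assumes "f \<in> forms N D" "g \<in> forms N E"
  shows "f * g \<in> forms N (D + E)"
proof -
  have "Poly_Mapping.keys k \<subseteq> {..N} \<and> (\<Sum>j\<in>Poly_Mapping.keys k. Poly_Mapping.lookup k j) = D + E"
    if k: "k \<in> Poly_Mapping.keys (f * g)" for k
  proof -
    obtain m m' where "k = m + m'" "m \<in> Poly_Mapping.keys f" "m' \<in> Poly_Mapping.keys g"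
      using k keys_mult[of f g] by blast
    then show ?thesis
      using assms by (simp add: forms_def poly_ring_def keys_add_nat degree_add_nat[unfolded keys_add_nat])
  qed
  then show ?thesis
    by (auto simp: forms_def poly_ring_def)
qed

lemma form_nonzero_on_point:
  assumes "f \<in> forms N D" "P \<in> proj_space N" "x \<in> P" "y \<in> P" "mpol_eval f x \<noteq> 0"
  shows "mpol_eval f y \<noteq> 0"
proof -
  obtain z c d where "c \<noteq> 0" "d \<noteq> 0" "x = (\<lambda>j. c * z j)" "y = (\<lambda>j. d * z j)"
    using assms(2,3,4) unfolding proj_space_def pt_def by blast
  then show ?thesis
    using assms(1,5) by (simp add: mpol_eval_scale)
qed

lemma istopology_zariski: "istopology (zariski_open N :: 'k::field ppoint set \<Rightarrow> bool)"
  unfolding istopology_def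
proof (intro conjI allI impI)
  fix U V :: "'k ppoint set"
  assume "zariski_open N U" "zariski_open N V"
  then obtain S T where S: "S \<subseteq> (\<Union>D. forms N D)" "U = proj_space N - proj_zeros N S"
    and T: "T \<subseteq> (\<Union>D. forms N D)" "V = proj_space N - proj_zeros N T"
    unfolding zariski_open_def by blast
  let ?R = "{f * g | f g. f \<in> S \<and> g \<in> T}"
  have R: "?R \<subseteq> (\<Union>D. forms N D)"
  proof
    fix h assume "h \<in> ?R"
    then obtain f g where "h = f * g" "f \<in> S" "g \<in> T" by blast
    moreover from this obtain D E where "f \<in> forms N D" "g \<in> forms N E"
      using S(1) T(1) by blast
    ultimately show "h \<in> (\<Union>D. forms N D)"
      using forms_mult by blast
  qed
  have "U \<inter> V \<subseteq> proj_space N - proj_zeros N ?R"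
  proof
    fix P assume P: "P \<in> U \<inter> V"
    then have PN: "P \<in> proj_space N" using S(2) by blast
    obtain f x where f: "f \<in> S" "x \<in> P" "mpol_eval f x \<noteq> 0"
      using P S(2) by (auto simp: proj_zeros_def)
    obtain g y where g: "g \<in> T" "y \<in> P" "mpol_eval g y \<noteq> 0"
      using P T(2) by (auto simp: proj_zeros_def)
    obtain E where "g \<in> forms N E" using g(1) T(1) by blast
    then have "mpol_eval g x \<noteq> 0"
      using form_nonzero_on_point[OF _ PN g(2) f(2) g(3)] by blast
    then have "mpol_eval (f * g) x \<noteq> 0" using f(3) by (simp add: mpol_eval_mult)
    then show "P \<in> proj_space N - proj_zeros N ?R"
      using PN f(1,2) g(1) by (auto simp: proj_zeros_def)
  qed
  moreover have "proj_space N - proj_zeros N ?R \<subseteq> U \<inter> V"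
    unfolding S(2) T(2) by (auto simp: proj_zeros_def mpol_eval_mult)
  ultimately show "zariski_open N (U \<inter> V)"
    unfolding zariski_open_def using R by blast
next
  fix \<U> :: "'k ppoint set set"
  assume "\<forall>U\<in>\<U>. zariski_open N U"
  then obtain S where S: "\<And>U. U \<in> \<U> \<Longrightarrow> S U \<subseteq> (\<Union>D. forms N D)"
      "\<And>U. U \<in> \<U> \<Longrightarrow> U = proj_space N - proj_zeros N (S U)"
    unfolding zariski_open_def by metis
  have "\<Union>\<U> = (\<Union>U\<in>\<U>. U)"
    by simp
  also have "\<dots> = (\<Union>U\<in>\<U>. proj_space N - proj_zeros N (S U))"
    by (rule SUP_cong[OF refl]) (erule S(2))
  also have "\<dots> = proj_space N - proj_zeros N (\<Union>U\<in>\<U>. S U)"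
    by (auto simp: proj_zeros_def)
  finally have eq: "\<Union>\<U> = proj_space N - proj_zeros N (\<Union>U\<in>\<U>. S U)" .
  have "(\<Union>U\<in>\<U>. S U) \<subseteq> (\<Union>D. forms N D)"
    by (rule UN_least) (rule S(1))
  with eq show "zariski_open N (\<Union>\<U>)"
    unfolding zariski_open_def by (intro exI[of _ "\<Union>U\<in>\<U>. S U"] conjI)
qed

lemma openin_zariski: "openin (zariski N) U \<longleftrightarrow> zariski_open N U"
  by (simp add: zariski_def istopology_zariski)

lemma mpol_eval_one: "mpol_eval 1 x = 1"
  using mpol_eval_single[of 0 1 x] by (simp add: monom_eval_def)

lemma proj_space_nonempty_point:
  assumes "P \<in> proj_space N"
  shows "\<exists>x. x \<in> P"
proof -
  obtain x where "P = pt x"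
    using assms by (auto simp: proj_space_def)
  then have "(\<lambda>j. 1 * x j) \<in> P"
    unfolding pt_def using one_neq_zero by blast
  then show ?thesis by blast
qed

lemma topspace_zariski: "topspace (zariski N) = (proj_space N :: 'k::field ppoint set)"
proof
  show "topspace (zariski N) \<subseteq> (proj_space N :: 'k ppoint set)"
    by (auto simp: topspace_def openin_zariski zariski_open_def)
next
  have "(1 :: 'k mpol) \<in> forms N 0"
    by (simp add: forms_def poly_ring_def)
  moreover have "proj_zeros N {1 :: 'k mpol} = {}"
    using proj_space_nonempty_point by (fastforce simp: proj_zeros_def mpol_eval_one)
  ultimately have "zariski_open N (proj_space N :: 'k ppoint set)"
    unfolding zariski_open_def by (intro exI[of _ "{1}"]) auto
  then show "(proj_space N :: 'k ppoint set) \<subseteq> topspace (zariski N)"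
    by (simp add: openin_subset openin_zariski)
qed

lemma closedin_zariski:
  "closedin (zariski N) (C :: 'k::field ppoint set) \<longleftrightarrow>
     (\<exists>S \<subseteq> (\<Union>D. forms N D). C = proj_zeros N S)"
proof -
  have "proj_zeros N S \<subseteq> (proj_space N :: 'k ppoint set)" for S
    by (auto simp: proj_zeros_def)
  then show ?thesis
    unfolding closedin_def topspace_zariski openin_zariski zariski_open_def
    by (metis double_diff order_refl)
qed

section \<open>Krull dimension\<close>

definition irreducible_space :: "'a topology \<Rightarrow> bool" where
  "irreducible_space T \<longleftrightarrow> topspace T \<noteq> {} \<and>
     (\<forall>C D. closedin T C \<and> closedin T D \<and> topspace T = C \<union> D \<longrightarrow>
        C = topspace T \<or> D = topspace T)"

text \<open>With this convention the empty space has dimension \<open>-\<infinity>\<close>.\<close>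

definition krull_dim :: "'a topology \<Rightarrow> ereal" where
  "krull_dim T = Sup {ereal (real m) | m. \<exists>Z.
     (\<forall>j\<le>m. closedin T (Z j) \<and> irreducible_space (subtopology T (Z j))) \<and>
     (\<forall>j<m. Z j \<subset> Z (Suc j))}"

section \<open>The degrees omega_i\<close>

text \<open>The ideal of all polynomials vanishing at every homogeneous coordinate vector of every point
  of \<open>X\<close>.  Over an infinite field this is a homogeneous ideal.\<close>

definition vanishing_ideal :: "nat \<Rightarrow> 'k::field ppoint set \<Rightarrow> 'k mpol set" where
  "vanishing_ideal N X = {f \<in> poly_ring N. \<forall>P\<in>X. \<forall>x\<in>P. mpol_eval f x = 0}"

definition omega :: "nat \<Rightarrow> 'k::field ppoint set \<Rightarrow> 'k ppoint set \<Rightarrow> nat \<Rightarrow> nat" where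
  "omega N X U i = (LEAST D.
     krull_dim (subtopology (zariski N) (proj_zeros N (vanishing_ideal N X \<inter> forms N D) \<inter> U))
       \<le> ereal (real N - real i))"

section \<open>Toric varieties and their modules\<close>

text \<open>The integer \<open>a i j\<close> is the \<open>j\<close>-th coordinate (\<open>j < n\<close>) of the vector \<open>a_i\<close> (\<open>i \<le> N\<close>);
  values outside these ranges are irrelevant.\<close>

definition toric_map ::
    "nat \<Rightarrow> nat \<Rightarrow> (nat \<Rightarrow> nat \<Rightarrow> int) \<Rightarrow> (nat \<Rightarrow> 'k::field) \<Rightarrow> (nat \<Rightarrow> 'k) \<Rightarrow> 'k ppoint" where
  "toric_map N n a \<alpha> s = pt (\<lambda>i. if i \<le> N then \<alpha> i * (\<Prod>j<n. s j powi a i j) else 0)"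

definition toric_variety ::
    "nat \<Rightarrow> nat \<Rightarrow> (nat \<Rightarrow> nat \<Rightarrow> int) \<Rightarrow> (nat \<Rightarrow> 'k::field) \<Rightarrow> 'k ppoint set" where
  "toric_variety N n a \<alpha> = zariski N closure_of (toric_map N n a \<alpha> ` {s. \<forall>j<n. s j \<noteq> 0})"

definition differences_generate :: "nat \<Rightarrow> nat \<Rightarrow> (nat \<Rightarrow> nat \<Rightarrow> int) \<Rightarrow> bool" where
  "differences_generate N n a \<longleftrightarrow>
     (\<forall>z :: nat \<Rightarrow> int. \<exists>c :: nat \<Rightarrow> nat \<Rightarrow> int. \<forall>j<n.
        z j = (\<Sum>i\<le>N. \<Sum>k\<le>N. c i k * (a i j - a k j)))"

text \<open>The condition on the differences normalises the presentation so that \<open>dim X = n\<close>.\<close>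

definition toric_presentation ::
    "nat \<Rightarrow> nat \<Rightarrow> (nat \<Rightarrow> nat \<Rightarrow> int) \<Rightarrow> (nat \<Rightarrow> 'k::field) \<Rightarrow> 'k ppoint set \<Rightarrow> bool" where
  "toric_presentation N n a \<alpha> X \<longleftrightarrow>
     (\<forall>i\<le>N. \<alpha> i \<noteq> 0) \<and> differences_generate N n a \<and> X = toric_variety N n a \<alpha>"

definition toric_module :: "nat \<Rightarrow> nat \<Rightarrow> (nat \<Rightarrow> nat \<Rightarrow> int) \<Rightarrow> (nat \<Rightarrow> int) set" where
  "toric_module N n a = {l. (\<forall>i>N. l i = 0) \<and> (\<Sum>i\<le>N. l i) = 0 \<and>
     (\<forall>j<n. (\<Sum>i\<le>N. l i * a i j) = 0)}"

section \<open>Successive minima\<close>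

definition l1_norm :: "nat \<Rightarrow> (nat \<Rightarrow> int) \<Rightarrow> real" where
  "l1_norm N v = (\<Sum>i\<le>N. \<bar>real_of_int (v i)\<bar>)"

definition lin_indep_family :: "nat \<Rightarrow> (nat \<Rightarrow> nat \<Rightarrow> int) \<Rightarrow> bool" where
  "lin_indep_family i v \<longleftrightarrow>
     (\<forall>c :: nat \<Rightarrow> int. (\<forall>k. (\<Sum>j<i. c j * v j k) = 0) \<longrightarrow> (\<forall>j<i. c j = 0))"

definition successive_min :: "(nat \<Rightarrow> int) set \<Rightarrow> ((nat \<Rightarrow> int) \<Rightarrow> real) \<Rightarrow> nat \<Rightarrow> real" where
  "successive_min \<Gamma> nrm i = (LEAST \<nu>. \<nu> \<ge> 0 \<and>
     (\<exists>v. lin_indep_family i v \<and> (\<forall>j<i. v j \<in> \<Gamma> \<and> nrm (v j) \<le> \<nu>)))"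

end

theory Submission
  imports Defs
begin

text \<open>Grouping the monomials of degree \<open>D\<close> by their characters shows that the degree \<open>D\<close> part of
  \<open>I(X)\<close> is spanned by binomials, so on the torus its zeros are the \<open>x\<close> with
  \<open>x\<^sup>l = \<alpha>\<^sup>l\<close> for the \<open>l \<in> \<Gamma>\<close> of norm at most \<open>2D\<close>.  If these \<open>l\<close> span a lattice of rank
  \<open>r\<close>, this set has dimension \<open>N - r\<close>.  It is at least that because the set contains a translate of
  a subtorus of that dimension.  It is at most that by counting: a chain of \<open>m + 1\<close> irreducible
  closed subsets yields \<open>m\<close> algebraically independent functions, hence at least of the order of
  \<open>d\<^sup>m\<close> linearly independent forms of degree \<open>d\<close>, whereas monomials that agree modulo the lattice
  are proportional on the set, which leaves only of the order of \<open>d\<^sup>N\<^sup>-\<^sup>r\<close> many.  So the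
  dimension is at most \<open>N - i\<close> iff \<open>\<mu>\<^sub>i \<le> 2D\<close>, and all norms on \<open>\<Gamma>\<close> are even integers.\<close>

section \<open>Linear systems\<close>

text \<open>The short vectors of \<Gamma> need not generate a saturated lattice, so their zero set
  on the torus may have several components, and rational linear algebra would lose information: a
  character trivial on \<open>q * l\<close> need not be trivial on \<open>l\<close>. Elimination is
  therefore carried out over the integers with one common denominator \<open>q\<close>. In the upper
  bound \<open>q\<close> costs only a constant factor in the number of classes; in the lower bound
  it suffices to exhibit one component, the one through \<alpha>, which a monomial map parametrises.
  The exponent \<open>N - r\<close> instead of \<open>N + 1 - r\<close> comes from homogeneity. In
  the count, the fixed total degree determines one coordinate; in the parametrisation, one
  coordinate outside the pivots serves as reference. Both arguments choose an index
  \<open>k0\<close> for this purpose. The functions attached to a chain come from forms of unrelated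
  degrees. Setting the zeroth coordinate to one makes them comparable, since its powers raise
  degrees without changing values.\<close>

lemma underdetermined_system:
  fixes A :: "'e \<Rightarrow> 'u \<Rightarrow> 'a::idom"
  assumes "finite E" "finite U" "card E < card U"
  shows "\<exists>c. (\<exists>u\<in>U. c u \<noteq> 0) \<and> (\<forall>e\<in>E. (\<Sum>u\<in>U. A e u * c u) = 0)"
  using assms
proof (induction E arbitrary: U A rule: finite_induct)
  case empty
  then obtain u where "u \<in> U" by fastforce
  then show ?case by (intro exI[of _ "\<lambda>_. 1"]) auto
next
  case (insert e E)
  show ?case
  proof (cases "\<forall>u\<in>U. A e u = 0")
    case True
    then show ?thesis using insert.IH[of U A] insert.prems insert.hyps by auto
  next
    case False
    then obtain u0 where u0: "u0 \<in> U" "A e u0 \<noteq> 0" by blast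
    let ?U = "U - {u0}"
    \<comment> \<open>Cross-multiplication with the pivot \<open>A e u0\<close> replaces division,
      so that the lemma serves integer systems as well as systems over the field. In
      \<open>d\<close> the eliminated unknown gets minus the rest of equation \<open>e\<close>, and
      all others are multiplied by the pivot.\<close>
    let ?B = "\<lambda>f u. A e u0 * A f u - A f u0 * A e u"
    have "card E < card ?U"
      using insert.prems insert.hyps u0 by simp
    then obtain c where c: "\<exists>u\<in>?U. c u \<noteq> 0" "\<forall>f\<in>E. (\<Sum>u\<in>?U. ?B f u * c u) = 0"
      using insert.IH[of ?U ?B] insert.prems by auto
    define d where "d = (\<lambda>u. if u = u0 then - (\<Sum>u\<in>?U. A e u * c u) else A e u0 * c u)"
    have split: "(\<Sum>u\<in>U. A f u * d u) =
        A e u0 * (\<Sum>u\<in>?U. A f u * c u) - A f u0 * (\<Sum>u\<in>?U. A e u * c u)" for f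
    proof -
      have "(\<Sum>u\<in>?U. A f u * d u) = A e u0 * (\<Sum>u\<in>?U. A f u * c u)"
        unfolding sum_distrib_left by (rule sum.cong) (auto simp: d_def)
      then show ?thesis
        using sum.remove[OF insert.prems(1) u0(1), of "\<lambda>u. A f u * d u"] by (simp add: d_def)
    qed
    have "(\<Sum>u\<in>U. A f u * d u) = (\<Sum>u\<in>?U. ?B f u * c u)" for f
      unfolding split
      by (simp add: sum_subtractf left_diff_distrib sum_distrib_left mult.assoc)
    then have "(\<Sum>u\<in>U. A f u * d u) = 0" if "f \<in> E" for f
      using c(2) that by simp
    moreover have "(\<Sum>u\<in>U. A e u * d u) = 0"
      unfolding split by simp
    moreover have "\<exists>u\<in>U. d u \<noteq> 0"
      using c(1) u0 by (auto simp: d_def)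
    ultimately show ?thesis by blast
  qed
qed

section \<open>Integer vectors in echelon form\<close>

definition int_span :: "nat \<Rightarrow> (nat \<Rightarrow> nat \<Rightarrow> int) \<Rightarrow> (nat \<Rightarrow> int) set" where
  "int_span r v = {x. \<exists>c. \<forall>k. x k = (\<Sum>l<r. c l * v l k)}"

lemma int_span_diff_scale:
  assumes "x \<in> int_span r v" "y \<in> int_span r v"
  shows "(\<lambda>k. p * x k - s * y k) \<in> int_span r v"
proof -
  obtain c d where "\<forall>k. x k = (\<Sum>l<r. c l * v l k)" "\<forall>k. y k = (\<Sum>l<r. d l * v l k)"
    using assms by (auto simp: int_span_def)
  then have "\<forall>k. p * x k - s * y k = (\<Sum>l<r. (p * c l - s * d l) * v l k)"
    by (simp add: sum_distrib_left sum_subtractf left_diff_distrib mult.assoc)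
  then show ?thesis
    unfolding int_span_def by (intro CollectI exI[of _ "\<lambda>l. p * c l - s * d l"])
qed

lemma int_span_scale: "x \<in> int_span r v \<Longrightarrow> (\<lambda>k. p * x k) \<in> int_span r v"
  using int_span_diff_scale[of x r v x p 0] by simp

lemma int_span_zero: "(\<lambda>_. 0) \<in> int_span r v"
  by (auto simp: int_span_def intro!: exI[of _ "\<lambda>_. 0"])

lemma int_span_minus_sum:
  assumes "finite J" "x \<in> int_span r v" "\<And>j. j \<in> J \<Longrightarrow> \<mu> j \<in> int_span r v"
  shows "(\<lambda>k. x k - (\<Sum>j\<in>J. s j * \<mu> j k)) \<in> int_span r v"
  using assms
proof (induction J rule: finite_induct)
  case (insert i J)
  then have "(\<lambda>k. 1 * (x k - (\<Sum>j\<in>J. s j * \<mu> j k)) - s i * \<mu> i k) \<in> int_span r v"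
    by (intro int_span_diff_scale) auto
  then show ?case using insert.hyps by (simp add: algebra_simps)
qed simp

lemma int_span_base:
  assumes "l < r" shows "v l \<in> int_span r v"
proof -
  have "v l k = (\<Sum>l'<r. (if l' = l then 1 else 0) * v l' k)" for k
    using assms by (simp add: if_distrib[of "\<lambda>c. c * _"] sum.delta cong: if_cong)
  then show ?thesis
    unfolding int_span_def by (intro CollectI exI[of _ "\<lambda>l'. if l' = l then 1 else 0"] allI)
qed

lemma int_span_Suc:
  assumes "x \<in> int_span r v" shows "x \<in> int_span (Suc r) v"
proof -
  obtain c where "\<forall>k. x k = (\<Sum>l<r. c l * v l k)"
    using assms by (auto simp: int_span_def)
  then have "\<forall>k. x k = (\<Sum>l<Suc r. (if l < r then c l else 0) * v l k)" by simp
  then show ?thesis unfolding int_span_def by (intro CollectI exI)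
qed

lemma lin_indep_family_mono:
  assumes "lin_indep_family r v" "i \<le> r"
  shows "lin_indep_family i v"
  unfolding lin_indep_family_def
proof (intro allI impI)
  fix c :: "nat \<Rightarrow> int" and j
  assume c: "\<forall>k. (\<Sum>j<i. c j * v j k) = 0" and j: "j < i"
  let ?c = "\<lambda>j. if j < i then c j else 0"
  have "(\<Sum>j<r. ?c j * v j k) = (\<Sum>j<i. c j * v j k)" for k
    using assms(2) by (intro sum.mono_neutral_cong_right) auto
  then have "\<forall>j<r. ?c j = 0"
    using assms(1)[unfolded lin_indep_family_def, rule_format, of ?c] c by simp
  then show "c j = 0" using j assms(2) by (metis less_le_trans)
qed

text \<open>A reduced echelon form with common pivot value \<open>q\<close> in the columns
  \<open>J\<close>, whose rows \<open>\<mu> j\<close> stay integral combinations of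
  \<open>v\<close>. It gives a membership test without unknown coefficients: \<open>x\<close> lies
  in the rational span of \<open>v\<close> iff \<open>q * x\<close> is the combination of the rows
  whose coefficients are the entries of \<open>x\<close> at \<open>J\<close>.\<close>

definition echelon ::
    "nat \<Rightarrow> nat \<Rightarrow> (nat \<Rightarrow> nat \<Rightarrow> int) \<Rightarrow> nat set \<Rightarrow> int \<Rightarrow> (nat \<Rightarrow> nat \<Rightarrow> int) \<Rightarrow> bool" where
  "echelon N r v J q \<mu> \<longleftrightarrow> J \<subseteq> {..N} \<and> card J = r \<and> q > 0 \<and>
     (\<forall>j\<in>J. \<mu> j \<in> int_span r v \<and> (\<forall>j'\<in>J. \<mu> j j' = (if j' = j then q else 0))) \<and>
     (\<forall>l<r. \<forall>k. q * v l k = (\<Sum>j\<in>J. v l j * \<mu> j k))"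

text \<open>One step of fraction-free Gaussian elimination.\<close>

lemma echelon_step:
  assumes e: "echelon N r v J q \<mu>"
    and supp: "\<And>k. k > N \<Longrightarrow> v r k = 0" "\<And>l k. l < r \<Longrightarrow> k > N \<Longrightarrow> v l k = 0"
    and nz: "q * v r m \<noteq> (\<Sum>j\<in>J. v r j * \<mu> j m)"
  shows "\<exists>J q \<mu>. echelon N (Suc r) v J q \<mu>"
proof -
  have J: "J \<subseteq> {..N}" "card J = r" and q: "q > 0"
    and sp: "\<And>j. j \<in> J \<Longrightarrow> \<mu> j \<in> int_span r v"
    and mu: "\<And>j j'. j \<in> J \<Longrightarrow> j' \<in> J \<Longrightarrow> \<mu> j j' = (if j' = j then q else 0)"
    and rel: "\<And>l k. l < r \<Longrightarrow> q * v l k = (\<Sum>j\<in>J. v l j * \<mu> j k)"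
    using e by (auto simp: echelon_def)
  have fin: "finite J" using J(1) finite_subset by blast
  define w0 where "w0 = (\<lambda>k. q * v r k - (\<Sum>j\<in>J. v r j * \<mu> j k))"
  have w0J: "w0 k = 0" if "k \<in> J" for k
  proof -
    have "(\<Sum>j\<in>J. v r j * \<mu> j k) = (\<Sum>j\<in>J. if k = j then v r j * q else 0)"
      using mu that by (intro sum.cong) auto
    then show ?thesis using that fin by (simp add: w0_def)
  qed
  have w0sp: "w0 \<in> int_span (Suc r) v"
    unfolding w0_def
    by (intro int_span_minus_sum int_span_scale int_span_base fin int_span_Suc sp) auto
  \<comment> \<open>The sign makes the new pivot \<open>p\<close> positive, as the common pivot
    value has to be.\<close>
  define \<epsilon> where "\<epsilon> = sgn (w0 m)"
  have w0m: "w0 m \<noteq> 0" using nz by (simp add: w0_def)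
  define w where "w = (\<lambda>k. \<epsilon> * w0 k)"
  define p where "p = w m"
  have p: "p > 0" using w0m by (simp add: p_def w_def \<epsilon>_def abs_sgn[symmetric] mult.commute)
  have \<epsilon>\<epsilon>: "\<epsilon> * \<epsilon> = 1" using w0m by (simp add: \<epsilon>_def sgn_if)
  have wJ: "w k = 0" if "k \<in> J" for k using w0J that by (simp add: w_def)
  have wsp: "w \<in> int_span (Suc r) v" unfolding w_def by (rule int_span_scale[OF w0sp])
  have mJ: "m \<notin> J" using w0J w0m by blast
  have "\<mu> j k = 0" if "j \<in> J" "k > N" for j k
    using sp[OF that(1)] that(2) supp by (auto simp: int_span_def)
  then have "w0 k = 0" if "k > N" for k
    using that supp by (simp add: w0_def)
  then have mN: "m \<le> N" using w0m by (meson leI)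
  \<comment> \<open>All rows are brought to the new common pivot \<open>p * q\<close>, and the old
    ones are cleared in column \<open>m\<close>.\<close>
  define \<mu>' where "\<mu>' = (\<lambda>j k. if j = m then q * w k else p * \<mu> j k - \<mu> j m * w k)"
  \<comment> \<open>\<open>t\<close> is the multiple of \<open>w\<close> missing from the old
    expansion: zero for the old vectors, \<open>\<epsilon>\<close> for the new one.\<close>
  have rel': "(p * q) * x k = (\<Sum>j\<in>insert m J. x j * \<mu>' j k)"
    if x: "\<And>k. q * x k = (\<Sum>j\<in>J. x j * \<mu> j k) + t * w k" for x k t
  proof -
    have "(\<Sum>j\<in>J. x j * \<mu>' j k) = (\<Sum>j\<in>J. x j * (p * \<mu> j k - \<mu> j m * w k))"
      using mJ by (intro sum.cong) (auto simp: \<mu>'_def)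
    also have "\<dots> = p * (\<Sum>j\<in>J. x j * \<mu> j k) - (\<Sum>j\<in>J. x j * \<mu> j m) * w k"
      by (simp add: sum_distrib_left sum_distrib_right sum_subtractf algebra_simps)
    also have "\<dots> = p * (q * x k - t * w k) - (q * x m - t * p) * w k"
      using x[of k] x[of m] by (simp add: p_def)
    also have "\<dots> = p * q * x k - x m * (q * w k)"
      by (simp add: algebra_simps)
    finally show ?thesis using mJ fin by (simp add: \<mu>'_def)
  qed
  have "(p * q) * v l k = (\<Sum>j\<in>insert m J. v l j * \<mu>' j k)" if "l < Suc r" for l k
  proof (cases "l < r")
    case True
    then show ?thesis using rel'[of "v l" 0] rel by simp
  next
    case False
    then have "l = r" using that by simp
    have "q * v r k = (\<Sum>j\<in>J. v r j * \<mu> j k) + \<epsilon> * w k" for k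
      using \<epsilon>\<epsilon> by (simp add: w_def w0_def mult.assoc[symmetric])
    from rel'[OF this] show ?thesis unfolding \<open>l = r\<close> .
  qed
  moreover have "\<mu>' j \<in> int_span (Suc r) v" if "j \<in> insert m J" for j
  proof (cases "j = m")
    case True
    then have "\<mu>' j = (\<lambda>k. q * w k)" by (simp add: \<mu>'_def)
    then show ?thesis using int_span_scale[OF wsp] by simp
  next
    case False
    then have "\<mu>' j = (\<lambda>k. p * \<mu> j k - \<mu> j m * w k)" by (simp add: \<mu>'_def)
    then show ?thesis using int_span_diff_scale[OF int_span_Suc wsp] sp that False by simp
  qed
  moreover have "\<mu>' j j' = (if j' = j then p * q else 0)"
    if "j \<in> insert m J" "j' \<in> insert m J" for j j'
    using that mJ wJ mu by (auto simp: \<mu>'_def p_def)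
  moreover have "card (insert m J) = Suc r" using J mJ fin by simp
  ultimately have "echelon N (Suc r) v (insert m J) (p * q) \<mu>'"
    using J(1) mN p q unfolding echelon_def by auto
  then show ?thesis by blast
qed

lemma echelon_imp_relation:
  assumes e: "echelon N r v J q \<mu>" and q: "\<forall>k. q * x k = (\<Sum>j\<in>J. x j * \<mu> j k)"
  shows "\<exists>c. \<forall>k. q * x k = (\<Sum>l<r. c l * v l k)"
proof -
  have fin: "finite J" using e finite_subset by (auto simp: echelon_def)
  have "(\<lambda>k. - 1 * (0 - (\<Sum>j\<in>J. x j * \<mu> j k))) \<in> int_span r v"
    using e by (intro int_span_scale int_span_minus_sum fin int_span_zero) (auto simp: echelon_def)
  then show ?thesis using q by (simp add: int_span_def)
qed

lemma echelon_exists: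
  assumes "lin_indep_family r v" "\<And>l k. l < r \<Longrightarrow> k > N \<Longrightarrow> v l k = 0"
  shows "\<exists>J q \<mu>. echelon N r v J q \<mu>"
  using assms
proof (induction r)
  case 0
  have "echelon N 0 v {} 1 v" by (simp add: echelon_def)
  then show ?case by blast
next
  case (Suc r)
  then obtain J q \<mu> where e: "echelon N r v J q \<mu>"
    using lin_indep_family_mono[OF Suc.prems(1), of r] by auto
  have "\<exists>m. q * v r m \<noteq> (\<Sum>j\<in>J. v r j * \<mu> j m)"
  proof (rule ccontr)
    assume "\<not> ?thesis"
    then obtain c where c: "\<forall>k. q * v r k = (\<Sum>l<r. c l * v l k)"
      using echelon_imp_relation[OF e, of "v r"] by auto
    let ?c = "\<lambda>l. if l < r then c l else - q"
    have "(\<Sum>l<Suc r. ?c l * v l k) = 0" for k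
      using c by simp
    then have "?c r = 0"
      using Suc.prems(1)[unfolded lin_indep_family_def, rule_format, of ?c r] by blast
    then show False using e by (simp add: echelon_def)
  qed
  then obtain m where "q * v r m \<noteq> (\<Sum>j\<in>J. v r j * \<mu> j m)" by blast
  then show ?case
    using Suc.prems(2) by (intro echelon_step[OF e]) auto
qed

text \<open>One coordinate \<open>m\<close> at which the membership test fails suffices: a relation
  writes \<open>c r * x\<close> through \<open>v\<close>, so \<open>c r * x\<close> passes the test,
  which forces \<open>c r = 0\<close>, and the independence of \<open>v\<close> does the
  rest.\<close>

lemma lin_indep_family_extend:
  assumes li: "lin_indep_family r v" and e: "echelon N r v J q \<mu>"
    and nz: "q * x m \<noteq> (\<Sum>j\<in>J. x j * \<mu> j m)"
  shows "lin_indep_family (Suc r) (v(r := x))"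
  unfolding lin_indep_family_def
proof (intro allI impI)
  fix c :: "nat \<Rightarrow> int" and j
  assume c: "\<forall>k. (\<Sum>j<Suc r. c j * (v(r := x)) j k) = 0" and j: "j < Suc r"
  have c': "c r * x k = - (\<Sum>l<r. c l * v l k)" for k
  proof -
    have "(\<Sum>j<r. c j * (v(r := x)) j k) = (\<Sum>l<r. c l * v l k)"
      by (intro sum.cong) auto
    with c[rule_format, of k] show ?thesis by simp
  qed
  have "c r * (q * x m) = q * (c r * x m)" by simp
  also have "\<dots> = - (\<Sum>l<r. c l * (q * v l m))"
    by (simp add: c' sum_distrib_left mult_ac)
  also have "\<dots> = - (\<Sum>l<r. c l * (\<Sum>j\<in>J. v l j * \<mu> j m))"
    using e by (simp add: echelon_def)
  also have "\<dots> = - (\<Sum>j\<in>J. (\<Sum>l<r. c l * v l j) * \<mu> j m)"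
    by (simp add: sum_distrib_left sum_distrib_right mult.assoc) (rule sum.swap)
  also have "\<dots> = (\<Sum>j\<in>J. (c r * x j) * \<mu> j m)"
    by (simp add: c' sum_negf)
  also have "\<dots> = c r * (\<Sum>j\<in>J. x j * \<mu> j m)"
    by (simp add: sum_distrib_left mult.assoc)
  finally have "c r = 0" using nz by simp
  moreover from this have "\<forall>l<r. c l = 0"
    using c' li unfolding lin_indep_family_def by simp
  ultimately show "c j = 0" using j by (auto simp: less_Suc_eq)
qed

text \<open>\<open>G\<close> is an arbitrary set of vectors, later those of bounded norm, so its
  rank is taken as the length of a longest independent family; distinct pivot columns bound this by
  \<open>N + 1\<close>. Every element of \<open>G\<close> passes the membership test, as otherwise
  the family could be extended.\<close>

lemma maximal_echelon:
  assumes supp: "\<And>x k. x \<in> G \<Longrightarrow> k > N \<Longrightarrow> x k = (0::int)"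
  shows "\<exists>r v J q \<mu>. lin_indep_family r v \<and> (\<forall>l<r. v l \<in> G) \<and> echelon N r v J q \<mu> \<and>
    (\<forall>x\<in>G. \<forall>k. q * x k = (\<Sum>j\<in>J. x j * \<mu> j k))"
proof -
  define Q where "Q = (\<lambda>r. \<exists>v. lin_indep_family r v \<and> (\<forall>l<r. v l \<in> G))"
  have bound: "r \<le> Suc N" if "Q r" for r
  proof -
    obtain v where "lin_indep_family r v" "\<forall>l<r. v l \<in> G" using \<open>Q r\<close> unfolding Q_def by blast
    then obtain J q \<mu> where "echelon N r v J q \<mu>" using echelon_exists[of r v N] supp by blast
    then have "J \<subseteq> {..N}" "card J = r" by (auto simp: echelon_def)
    then show ?thesis using card_mono[of "{..N}" J] by simp
  qed
  have "Q 0" by (simp add: Q_def lin_indep_family_def)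
  then obtain r where r: "Q r" "\<And>r'. Q r' \<Longrightarrow> r' \<le> r"
    using bound Nat.ex_has_greatest_nat[of Q 0 "Suc N"] by blast
  obtain v where v: "lin_indep_family r v" "\<forall>l<r. v l \<in> G" using r(1) unfolding Q_def by blast
  then obtain J q \<mu> where e: "echelon N r v J q \<mu>" using echelon_exists[of r v N] supp by blast
  have "q * x k = (\<Sum>j\<in>J. x j * \<mu> j k)" if "x \<in> G" for x k
  proof (rule ccontr)
    assume "\<not> ?thesis"
    then have "lin_indep_family (Suc r) (v(r := x))" by (rule lin_indep_family_extend[OF v(1) e])
    moreover have "\<forall>l<Suc r. (v(r := x)) l \<in> G" using v(2) that by simp
    ultimately have "Q (Suc r)" unfolding Q_def by blast
    then show False using r(2) by fastforce
  qed
  with v e show ?thesis by blast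
qed

text \<open>If a maximal family had length \<open>r < i\<close>, then adding to the
  \<open>n + 1\<close> equations of the module the vanishing of the \<open>r\<close> pivot entries
  would still leave an underdetermined system. But an element of the module is determined by its
  pivot entries.\<close>

lemma toric_module_rank:
  assumes "i \<le> N - n"
  shows "\<exists>v. lin_indep_family i v \<and> (\<forall>l<i. v l \<in> toric_module N n a)"
proof -
  obtain r v J q \<mu> where v: "lin_indep_family r v" "\<forall>l<r. v l \<in> toric_module N n a"
    and e: "echelon N r v J q \<mu>"
    and mx: "\<forall>x\<in>toric_module N n a. \<forall>k. q * x k = (\<Sum>j\<in>J. x j * \<mu> j k)"
    using maximal_echelon[of "toric_module N n a" N] by (auto simp: toric_module_def)
  have J: "J \<subseteq> {..N}" "card J = r" "q > 0" using e by (auto simp: echelon_def)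
  have "i \<le> r"
  proof (rule ccontr)
    assume ir: "\<not> i \<le> r"
    \<comment> \<open>\<open>Inl j\<close> stands for the vanishing of the pivot entry
      \<open>j\<close>, \<open>Inr j\<close> with \<open>j < n\<close> for orthogonality to the
      \<open>j\<close>-th coordinates, and \<open>Inr n\<close> for the zero sum.\<close>
    let ?E = "Inl ` J \<union> Inr ` {..n} :: (nat + nat) set"
    let ?A = "\<lambda>e k. case e of Inl j \<Rightarrow> if k = j then 1 else 0
                 | Inr j \<Rightarrow> if j < n then a k j else (1::int)"
    have fJ: "finite J" using J(1) finite_subset by blast
    have "card ?E = r + Suc n"
      using J fJ by (subst card_Un_disjoint) (auto simp: card_image)
    then have card_less: "card ?E < card {..N}" using ir assms by simp
    have fin: "finite ?E" "finite {..N}" using fJ by auto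
    then obtain c where c: "\<exists>k\<in>{..N}. c k \<noteq> 0" "\<forall>e\<in>?E. (\<Sum>k\<in>{..N}. ?A e k * c k) = 0"
      using underdetermined_system[of ?E "{..N}" ?A] fin card_less by blast
    define x where "x = (\<lambda>k. if k \<le> N then c k else 0)"
    have "(\<Sum>k\<le>N. c k) = 0" using c(2)[rule_format, of "Inr n"] by simp
    moreover have "(\<Sum>k\<le>N. c k * a k j) = 0" if "j < n" for j
      using c(2)[rule_format, of "Inr j"] that by (simp add: mult.commute)
    ultimately have x: "x \<in> toric_module N n a"
      by (simp add: toric_module_def x_def)
    have "x j = 0" if "j \<in> J" for j
    proof -
      have "(\<Sum>k\<in>{..N}. (if k = j then 1 else 0) * c k) = 0"
        using c(2)[rule_format, of "Inl j"] that by simp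
      moreover have "(\<Sum>k\<in>{..N}. (if k = j then 1 else 0) * c k) = x j"
        by (simp add: x_def if_distrib[of "\<lambda>c. c * _"] sum.delta' cong: if_cong)
      ultimately show ?thesis by simp
    qed
    then have "q * x k = 0" for k using mx x by simp
    then have "x k = 0" for k using J(3) by simp
    then show False using c(1) unfolding x_def by (metis atMost_iff)
  qed
  then show ?thesis using v lin_indep_family_mono by (meson less_le_trans)
qed

section \<open>Characters of the torus\<close>

definition chr :: "nat \<Rightarrow> (nat \<Rightarrow> 'k::field) \<Rightarrow> (nat \<Rightarrow> int) \<Rightarrow> 'k" where
  "chr N y l = (\<Prod>k\<le>N. y k powi l k)"

lemma power_int_sum: "x \<noteq> 0 \<Longrightarrow> (x::'a::field) powi (\<Sum>a\<in>A. f a) = (\<Prod>a\<in>A. x powi f a)"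
  by (induction A rule: infinite_finite_induct) (auto simp: power_int_add)

lemma prod_power_int: "(\<Prod>a\<in>A. f a powi m) = ((\<Prod>a\<in>A. f a) :: 'a::field) powi m"
  by (induction A rule: infinite_finite_induct) (auto simp: power_int_mult_distrib)

lemma chr_diff:
  assumes "\<And>k. k \<le> N \<Longrightarrow> y k \<noteq> 0"
  shows "chr N y (\<lambda>k. l k - l' k) = chr N y l / chr N y l'"
  using assms by (simp add: chr_def power_int_diff prod_dividef)

lemma chr_nonzero: "(\<And>k. k \<le> N \<Longrightarrow> y k \<noteq> 0) \<Longrightarrow> chr N y l \<noteq> 0"
  by (auto simp: chr_def)

lemma chr_divide: "chr N (\<lambda>k. x k / y k) l = chr N x l / chr N y l"
  by (simp add: chr_def prod_dividef power_int_divide_distrib)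

text \<open>Triviality of characters at \<open>y\<close> passes to integral combinations, not to
  rational ones; this is why membership in \<open>int_span\<close> is tracked throughout the
  elimination.\<close>

lemma chr_int_span:
  assumes y: "\<And>k. k \<le> N \<Longrightarrow> y k \<noteq> 0"
    and v: "\<And>l. l < r \<Longrightarrow> chr N y (v l) = 1"
    and x: "x \<in> int_span r v"
  shows "chr N y x = 1"
proof -
  obtain c where c: "\<forall>k. x k = (\<Sum>l<r. c l * v l k)" using x by (auto simp: int_span_def)
  have "chr N y x = (\<Prod>k\<le>N. \<Prod>l<r. (y k powi v l k) powi c l)"
    unfolding chr_def using y
    by (intro prod.cong refl) (auto simp: c power_int_sum power_int_mult[symmetric] mult.commute)
  also have "\<dots> = (\<Prod>l<r. \<Prod>k\<le>N. (y k powi v l k) powi c l)" by (rule prod.swap)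
  also have "\<dots> = (\<Prod>l<r. chr N y (v l) powi c l)" by (simp add: prod_power_int chr_def)
  finally show ?thesis using v by simp
qed

text \<open>Pulling a character back along a monomial map pairs the exponents. This serves both the
  parametrisation of the toric variety and that of a subtorus.\<close>

lemma chr_monomial_point:
  assumes "\<And>j. j \<in> C \<Longrightarrow> t j \<noteq> 0"
  shows "chr N (\<lambda>i. \<Prod>j\<in>C. t j powi w i j) l = (\<Prod>j\<in>C. t j powi (\<Sum>i\<le>N. l i * w i j))"
proof -
  have "chr N (\<lambda>i. \<Prod>j\<in>C. t j powi w i j) l = (\<Prod>i\<le>N. \<Prod>j\<in>C. t j powi (l i * w i j))"
    by (simp add: chr_def prod_power_int[symmetric] power_int_mult[symmetric] mult.commute)
  also have "\<dots> = (\<Prod>j\<in>C. \<Prod>i\<le>N. t j powi (l i * w i j))" by (rule prod.swap)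
  also have "\<dots> = (\<Prod>j\<in>C. t j powi (\<Sum>i\<le>N. l i * w i j))"
    using assms by (intro prod.cong refl) (simp add: power_int_sum)
  finally show ?thesis .
qed

text \<open>Euclid's argument: in a finite field, one plus the product of all
  \<open>[:- a, 1:]\<close> would have positive degree but no root.\<close>

lemma infinite_UNIV_alg_closed: "infinite (UNIV :: 'a::alg_closed_field set)"
proof
  assume fin: "finite (UNIV :: 'a set)"
  let ?p = "(\<Prod>a\<in>UNIV. [:- a, 1:]) + 1 :: 'a poly"
  have "degree (\<Prod>a\<in>UNIV. [:- a, 1:] :: 'a poly) = card (UNIV :: 'a set)"
    by (subst degree_prod_eq_sum_degree) auto
  moreover have "card (UNIV :: 'a set) > 0" using fin by (simp add: card_gt_0_iff)
  ultimately have "degree ?p > 0" by (subst degree_add_eq_left) auto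
  then obtain x where "poly ?p x = 0" using alg_closed_imp_poly_has_root by blast
  moreover have "poly ?p x = 1" using fin by (simp add: poly_prod prod_zero_iff)
  ultimately show False by simp
qed

lemma exists_power_neq_1:
  assumes inf: "infinite (UNIV :: 'a::field set)" and m: "m \<noteq> 0"
  shows "\<exists>c::'a. c \<noteq> 0 \<and> c powi m \<noteq> 1"
proof -
  define n where "n = nat \<bar>m\<bar>"
  have n: "n > 0" using m by (simp add: n_def)
  have "finite {c::'a. poly (monom 1 n - 1) c = 0}"
    using n by (intro poly_roots_finite)
      (metis degree_1 degree_monom_eq less_irrefl right_minus_eq zero_neq_one)
  then have "finite (insert 0 {c::'a. c ^ n = 1})" by (simp add: poly_monom)
  then obtain c where "c \<notin> insert 0 {c::'a. c ^ n = 1}" using inf ex_new_if_finite by blast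
  then have c: "c \<noteq> 0" "c ^ n \<noteq> 1" by auto
  have "c powi m \<noteq> 1"
    using c m by (cases "m \<ge> 0") (auto simp: n_def power_int_def power_inverse)
  then show ?thesis using c by blast
qed

text \<open>The Artin-Dedekind argument: translating by a point \<open>t\<close> that separates two
  characters and subtracting a multiple of the original relation yields a relation without
  \<open>\<psi>0\<close>. As the exponents vanish from \<open>n\<close> on, distinct ones differ in
  a coordinate that the torus sees.\<close>

lemma independent_characters:
  fixes c :: "(nat \<Rightarrow> int) \<Rightarrow> 'k::field"
  assumes inf: "infinite (UNIV :: 'k set)"
    and "finite A" "\<And>\<psi> j. \<psi> \<in> A \<Longrightarrow> j \<ge> n \<Longrightarrow> \<psi> j = 0"
    and "\<And>s. (\<forall>j<n. s j \<noteq> 0) \<Longrightarrow> (\<Sum>\<psi>\<in>A. c \<psi> * (\<Prod>j<n. s j powi \<psi> j)) = 0"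
  shows "\<forall>\<psi>\<in>A. c \<psi> = 0"
  using assms(2-)
proof (induction A arbitrary: c rule: finite_induct)
  case (insert \<psi>0 A)
  let ?e = "\<lambda>\<psi> s. \<Prod>j<n. s j powi \<psi> j :: 'k"
  have A: "c \<psi>1 = 0" if \<psi>1: "\<psi>1 \<in> A" for \<psi>1
  proof -
    have "\<psi>0 \<noteq> \<psi>1" using insert.hyps \<psi>1 by blast
    then obtain j where j: "\<psi>0 j \<noteq> \<psi>1 j" by blast
    then have jn: "j < n" using insert.prems(1) \<psi>1 by (metis insertCI not_le)
    obtain b :: 'k where b: "b \<noteq> 0" "b powi (\<psi>1 j - \<psi>0 j) \<noteq> 1"
      using exists_power_neq_1[OF inf, of "\<psi>1 j - \<psi>0 j"] j by auto
    define t where "t = (\<lambda>i. if i = j then b else 1)"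
    have e_t: "?e \<psi> t = b powi \<psi> j" for \<psi>
      using jn by (simp add: t_def if_distrib[of "\<lambda>c. c powi _"] prod.delta cong: if_cong)
    have "(\<Sum>\<psi>\<in>A. (c \<psi> * (?e \<psi> t - ?e \<psi>0 t)) * ?e \<psi> s) = 0" if s: "\<forall>j<n. s j \<noteq> 0" for s
    proof -
      have st: "?e \<psi> (\<lambda>j. s j * t j) = ?e \<psi> s * ?e \<psi> t" for \<psi>
        by (simp add: power_int_mult_distrib prod.distrib)
      have "\<forall>j<n. s j * t j \<noteq> 0" using s b(1) by (simp add: t_def)
      from insert.prems(2)[OF this]
      have 1: "c \<psi>0 * (?e \<psi>0 s * ?e \<psi>0 t) + (\<Sum>\<psi>\<in>A. c \<psi> * (?e \<psi> s * ?e \<psi> t)) = 0"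
        unfolding st using insert.hyps by simp
      have 2: "c \<psi>0 * ?e \<psi>0 s + (\<Sum>\<psi>\<in>A. c \<psi> * ?e \<psi> s) = 0"
        using insert.prems(2)[OF s] insert.hyps by simp
      have "(\<Sum>\<psi>\<in>A. (c \<psi> * (?e \<psi> t - ?e \<psi>0 t)) * ?e \<psi> s) =
          (\<Sum>\<psi>\<in>A. c \<psi> * (?e \<psi> s * ?e \<psi> t)) - ?e \<psi>0 t * (\<Sum>\<psi>\<in>A. c \<psi> * ?e \<psi> s)"
        by (simp add: sum_distrib_left sum_subtractf[symmetric] algebra_simps)
      also have "\<dots> = - (c \<psi>0 * (?e \<psi>0 s * ?e \<psi>0 t)) - ?e \<psi>0 t * - (c \<psi>0 * ?e \<psi>0 s)"
        using 1 2 by (simp only: add_eq_0_iff)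
      also have "\<dots> = 0" by simp
      finally show ?thesis .
    qed
    then have "\<forall>\<psi>\<in>A. c \<psi> * (?e \<psi> t - ?e \<psi>0 t) = 0"
      using insert.prems(1) by (intro insert.IH) auto
    moreover have "?e \<psi>1 t \<noteq> ?e \<psi>0 t"
      using b by (auto simp: e_t power_int_diff)
    ultimately show ?thesis using \<psi>1 by auto
  qed
  moreover have "c \<psi>0 = 0"
    using insert.prems(2)[of "\<lambda>_. 1"] insert.hyps A by simp
  ultimately show ?case by blast
qed simp

section \<open>Forms\<close>

definition exponent :: "nat \<Rightarrow> (nat \<Rightarrow> nat) \<Rightarrow> (nat \<Rightarrow>\<^sub>0 nat)" where
  "exponent N u = (\<Sum>k\<le>N. Poly_Mapping.single k (u k))"

lemma lookup_exponent: "Poly_Mapping.lookup (exponent N u) k = (if k \<le> N then u k else 0)"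
  by (simp add: exponent_def lookup_sum lookup_single when_def sum.delta)

lemma keys_exponent: "Poly_Mapping.keys (exponent N u) \<subseteq> {..N}"
  by (auto simp: in_keys_iff lookup_exponent split: if_splits)

lemma degree_superset:
  fixes m :: "nat \<Rightarrow>\<^sub>0 nat"
  assumes "Poly_Mapping.keys m \<subseteq> {..N}"
  shows "(\<Sum>j\<in>Poly_Mapping.keys m. Poly_Mapping.lookup m j) = (\<Sum>j\<le>N. Poly_Mapping.lookup m j)"
  by (rule sum.mono_neutral_left) (use assms in \<open>auto simp: in_keys_iff\<close>)

lemma formsD:
  assumes "f \<in> forms N D" "m \<in> Poly_Mapping.keys f"
  shows "Poly_Mapping.keys m \<subseteq> {..N}" "(\<Sum>j\<le>N. Poly_Mapping.lookup m j) = D"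
  using assms degree_superset[of m N] by (auto simp: forms_def poly_ring_def)

lemma formsI:
  assumes "\<And>m. m \<in> Poly_Mapping.keys f \<Longrightarrow>
    Poly_Mapping.keys m \<subseteq> {..N} \<and> (\<Sum>j\<le>N. Poly_Mapping.lookup m j) = D"
  shows "f \<in> forms N D"
  unfolding forms_def poly_ring_def using assms degree_superset[of _ N] by auto

lemma forms_add: "f \<in> forms N D \<Longrightarrow> g \<in> forms N D \<Longrightarrow> f + g \<in> forms N D"
  using Poly_Mapping.keys_add[of f g] unfolding forms_def poly_ring_def by blast

lemma lookup_const_mult:
  "Poly_Mapping.lookup (Poly_Mapping.single (0::nat \<Rightarrow>\<^sub>0 nat) c * f) m =
    (c::'k::comm_semiring_1) * Poly_Mapping.lookup f m"
proof -
  have "Poly_Mapping.single 0 c * f = Poly_Mapping.single 0 c *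
      (\<Sum>m\<in>Poly_Mapping.keys f. Poly_Mapping.single m (Poly_Mapping.lookup f m))"
    using mpol_decomp[of f] by (rule arg_cong)
  also have "\<dots> =
      (\<Sum>m\<in>Poly_Mapping.keys f. Poly_Mapping.single m (c * Poly_Mapping.lookup f m))"
    by (simp add: sum_distrib_left mult_single)
  finally show ?thesis
    by (auto simp: lookup_sum lookup_single when_def in_keys_iff)
qed

lemma single_in_forms:
  "Poly_Mapping.keys m \<subseteq> {..N} \<Longrightarrow> (\<Sum>j\<le>N. Poly_Mapping.lookup m j) = D \<Longrightarrow>
    Poly_Mapping.single m c \<in> forms N D"
  by (rule formsI) (auto split: if_splits)

lemma exponent_in_forms:
  "(\<Sum>j\<le>N. u j) = D \<Longrightarrow> Poly_Mapping.single (exponent N u) c \<in> forms N D"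
  by (intro single_in_forms keys_exponent) (simp add: lookup_exponent)

lemma const_in_forms: "Poly_Mapping.single 0 c \<in> forms N 0"
  by (rule single_in_forms) auto

lemma monom_eval_chr:
  assumes "Poly_Mapping.keys m \<subseteq> {..N}"
  shows "monom_eval x m = chr N x (\<lambda>k. int (Poly_Mapping.lookup m k))"
  using monom_eval_superset[of "{..N}" m x] assms by (simp add: chr_def)

text \<open>With \<open>y = x / \<alpha>\<close>, a monomial at \<open>x\<close> is its value at
  \<alpha> times a character of \<open>y\<close>, and this second factor is common to all monomials
  with equal label. So \<open>f\<close> at \<open>x\<close> is a combination of its class sums at
  \<alpha>. The labels will be torus characters in one use and classes modulo a lattice in the
  other.\<close>

lemma form_vanishes_by_classes:
  assumes M: "finite M" "Poly_Mapping.keys f \<subseteq> M" "\<And>u. u \<in> M \<Longrightarrow> Poly_Mapping.keys u \<subseteq> {..N}"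
    and nz: "\<And>k. k \<le> N \<Longrightarrow> x k \<noteq> 0" "\<And>k. k \<le> N \<Longrightarrow> \<alpha> k \<noteq> 0"
    and classes: "\<And>u u'. u \<in> M \<Longrightarrow> u' \<in> M \<Longrightarrow> \<kappa> u = \<kappa> u' \<Longrightarrow>
      chr N (\<lambda>k. x k / \<alpha> k) (\<lambda>k. int (Poly_Mapping.lookup u k) - int (Poly_Mapping.lookup u' k)) = 1"
    and zero: "\<And>\<psi>. \<psi> \<in> \<kappa> ` M \<Longrightarrow>
      (\<Sum>u\<in>{u \<in> M. \<kappa> u = \<psi>}. Poly_Mapping.lookup f u * monom_eval \<alpha> u) = 0"
  shows "mpol_eval f x = 0"
proof -
  let ?y = "\<lambda>k. x k / \<alpha> k" and ?i = "\<lambda>u k. int (Poly_Mapping.lookup u k)"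
  have y: "?y k \<noteq> 0" if "k \<le> N" for k using nz that by simp
  have mon: "monom_eval x u = monom_eval \<alpha> u * chr N ?y (?i u)" if "u \<in> M" for u
    using M(3)[OF that] chr_nonzero[of N \<alpha>] nz(2) by (simp add: monom_eval_chr chr_divide)
  have "mpol_eval f x = (\<Sum>u\<in>M. Poly_Mapping.lookup f u * monom_eval x u)"
    by (rule mpol_eval_superset[OF M(1,2)])
  also have "\<dots> = (\<Sum>\<psi>\<in>\<kappa> ` M. \<Sum>u\<in>{u \<in> M. \<kappa> u = \<psi>}. Poly_Mapping.lookup f u * monom_eval x u)"
    by (rule sum.image_gen[OF M(1)])
  also have "\<dots> = 0"
  proof (rule sum.neutral, rule ballI)
    fix \<psi> assume \<psi>: "\<psi> \<in> \<kappa> ` M"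
    then obtain u0 where u0: "u0 \<in> M" "\<kappa> u0 = \<psi>" by blast
    have "chr N ?y (?i u) = chr N ?y (?i u0)" if "u \<in> M" "\<kappa> u = \<psi>" for u
      using classes[OF that(1) u0(1)] that(2) u0(2) chr_diff[of N ?y "?i u" "?i u0"] y
      by (simp add: divide_eq_1_iff split: if_splits)
    then have "(\<Sum>u\<in>{u \<in> M. \<kappa> u = \<psi>}. Poly_Mapping.lookup f u * monom_eval x u) =
        (\<Sum>u\<in>{u \<in> M. \<kappa> u = \<psi>}. Poly_Mapping.lookup f u * monom_eval \<alpha> u) * chr N ?y (?i u0)"
      unfolding sum_distrib_right by (intro sum.cong) (auto simp: mon mult_ac)
    then show "(\<Sum>u\<in>{u \<in> M. \<kappa> u = \<psi>}. Poly_Mapping.lookup f u * monom_eval x u) = 0"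
      using zero[OF \<psi>] by simp
  qed
  finally show ?thesis .
qed

section \<open>Forms vanishing on a toric variety\<close>

definition toric_vec ::
    "nat \<Rightarrow> nat \<Rightarrow> (nat \<Rightarrow> nat \<Rightarrow> int) \<Rightarrow> (nat \<Rightarrow> 'k::field) \<Rightarrow> (nat \<Rightarrow> 'k) \<Rightarrow> nat \<Rightarrow> 'k" where
  "toric_vec N n a \<alpha> s = (\<lambda>i. if i \<le> N then \<alpha> i * (\<Prod>j<n. s j powi a i j) else 0)"

lemma l1_norm_degree_diff:
  assumes "(\<Sum>k\<le>N. u k) = D" "(\<Sum>k\<le>N. u' k) = D"
  shows "l1_norm N (\<lambda>k. int (u k) - int (u' k)) \<le> 2 * real D"
proof -
  have "l1_norm N (\<lambda>k. int (u k) - int (u' k)) \<le> (\<Sum>k\<le>N. real (u k) + real (u' k))"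
    unfolding l1_norm_def by (rule sum_mono) simp
  also have "\<dots> = real (\<Sum>k\<le>N. u k) + real (\<Sum>k\<le>N. u' k)" by (simp add: sum.distrib)
  finally show ?thesis using assms by simp
qed

text \<open>On a parametrised point \<open>f\<close> becomes a combination of torus characters whose
  coefficients are the class sums, and independence of characters kills these. Two exponents of
  degree \<open>D\<close> with the same character differ by a module element of norm at most
  \<open>2 * D\<close>, so the assumed relations suffice.\<close>

lemma toric_form_vanishes:
  fixes \<alpha> :: "nat \<Rightarrow> 'k::field"
  assumes inf: "infinite (UNIV :: 'k set)" and f: "f \<in> forms N D"
    and van: "\<And>s. (\<forall>j<n. s j \<noteq> 0) \<Longrightarrow> mpol_eval f (toric_vec N n a \<alpha> s) = 0"
    and nz: "\<And>k. k \<le> N \<Longrightarrow> x k \<noteq> 0" "\<And>k. k \<le> N \<Longrightarrow> \<alpha> k \<noteq> 0"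
    and rel: "\<And>l. l \<in> toric_module N n a \<Longrightarrow> l1_norm N l \<le> 2 * real D \<Longrightarrow>
      chr N (\<lambda>k. x k / \<alpha> k) l = 1"
  shows "mpol_eval f x = 0"
proof -
  let ?i = "\<lambda>u k. int (Poly_Mapping.lookup u k)"
  define M where "M = Poly_Mapping.keys f"
  define \<kappa> where "\<kappa> = (\<lambda>u j. if j < n then (\<Sum>k\<le>N. ?i u k * a k j) else 0)"
  define S where "S = (\<lambda>\<psi>. \<Sum>u\<in>{u \<in> M. \<kappa> u = \<psi>}. Poly_Mapping.lookup f u * monom_eval \<alpha> u)"
  have M: "finite M" "\<And>u. u \<in> M \<Longrightarrow> Poly_Mapping.keys u \<subseteq> {..N}"
      "\<And>u. u \<in> M \<Longrightarrow> (\<Sum>k\<le>N. Poly_Mapping.lookup u k) = D"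
    using formsD[OF f] by (auto simp: M_def)
  have "(\<Sum>\<psi>\<in>\<kappa> ` M. S \<psi> * (\<Prod>j<n. s j powi \<psi> j)) = 0" if s: "\<forall>j<n. s j \<noteq> 0" for s
  proof -
    have mon: "monom_eval (toric_vec N n a \<alpha> s) u = monom_eval \<alpha> u * (\<Prod>j<n. s j powi \<kappa> u j)"
      if "u \<in> M" for u
    proof -
      have "chr N (toric_vec N n a \<alpha> s) (?i u) =
          chr N \<alpha> (?i u) * chr N (\<lambda>i. \<Prod>j<n. s j powi a i j) (?i u)"
        by (simp add: chr_def toric_vec_def power_mult_distrib prod.distrib)
      also have "chr N (\<lambda>i. \<Prod>j<n. s j powi a i j) (?i u) = (\<Prod>j<n. s j powi \<kappa> u j)"
        using s by (subst chr_monomial_point) (auto simp: \<kappa>_def)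
      finally show ?thesis using M(2)[OF that] by (simp add: monom_eval_chr)
    qed
    have "0 = (\<Sum>u\<in>M. Poly_Mapping.lookup f u * monom_eval (toric_vec N n a \<alpha> s) u)"
      using van[OF s] by (simp add: mpol_eval_def M_def)
    also have "\<dots> = (\<Sum>\<psi>\<in>\<kappa> ` M. \<Sum>u\<in>{u \<in> M. \<kappa> u = \<psi>}.
        Poly_Mapping.lookup f u * monom_eval (toric_vec N n a \<alpha> s) u)"
      by (rule sum.image_gen[OF M(1)])
    also have "\<dots> = (\<Sum>\<psi>\<in>\<kappa> ` M. S \<psi> * (\<Prod>j<n. s j powi \<psi> j))"
      unfolding S_def sum_distrib_right by (intro sum.cong refl) (auto simp: mon mult_ac)
    finally show ?thesis by simp
  qed
  then have zero: "\<forall>\<psi>\<in>\<kappa> ` M. S \<psi> = 0"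
    using M(1) by (intro independent_characters[OF inf, of _ n]) (auto simp: \<kappa>_def)
  show ?thesis
  proof (rule form_vanishes_by_classes[of M f N x \<alpha> \<kappa>])
    show "chr N (\<lambda>k. x k / \<alpha> k) (\<lambda>k. ?i u k - ?i u' k) = 1"
      if u: "u \<in> M" "u' \<in> M" and eq: "\<kappa> u = \<kappa> u'" for u u'
    proof (rule rel)
      have "k \<notin> Poly_Mapping.keys u" "k \<notin> Poly_Mapping.keys u'" if "k > N" for k
        using M(2)[OF u(1)] M(2)[OF u(2)] that by (metis atMost_iff not_le subsetD)+
      then have "Poly_Mapping.lookup u k = 0" "Poly_Mapping.lookup u' k = 0" if "k > N" for k
        using that by (simp_all add: in_keys_iff)
      moreover have "(\<Sum>k\<le>N. ?i u k - ?i u' k) = 0"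
        using M(3) u by (simp add: sum_subtractf of_nat_sum[symmetric])
      moreover have "(\<Sum>k\<le>N. (?i u k - ?i u' k) * a k j) = 0" if "j < n" for j
        using fun_cong[OF eq, of j] that by (simp add: \<kappa>_def left_diff_distrib sum_subtractf)
      ultimately show "(\<lambda>k. ?i u k - ?i u' k) \<in> toric_module N n a"
        by (simp add: toric_module_def)
      show "l1_norm N (\<lambda>k. ?i u k - ?i u' k) \<le> 2 * real D"
        using M(3) u by (intro l1_norm_degree_diff) auto
    qed
  qed (use M nz zero in \<open>auto simp: M_def S_def\<close>)
qed

text \<open>As the entries sum to zero, the positive and negative parts have equal sums. This common
  sum is the least degree of a binomial with exponent difference \<open>l\<close>, hence the factor
  one half in the theorem.\<close>

lemma l1_norm_even:
  assumes "(\<Sum>k\<le>N. l k) = 0"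
  shows "l1_norm N l = 2 * real (\<Sum>k\<le>N. nat (l k))" "l1_norm N l = 2 * real (\<Sum>k\<le>N. nat (- l k))"
proof -
  have 1: "(\<Sum>k\<le>N. int (nat (l k))) - (\<Sum>k\<le>N. int (nat (- l k))) = (\<Sum>k\<le>N. l k)"
    unfolding sum_subtractf[symmetric] by (rule sum.cong) auto
  have 2: "l1_norm N l = (\<Sum>k\<le>N. real (nat (l k))) + (\<Sum>k\<le>N. real (nat (- l k)))"
    unfolding l1_norm_def sum.distrib[symmetric] by (rule sum.cong) auto
  have "(\<Sum>k\<le>N. nat (l k)) = (\<Sum>k\<le>N. nat (- l k))"
    using 1 assms by (simp only: of_nat_sum[symmetric])
  then show "l1_norm N l = 2 * real (\<Sum>k\<le>N. nat (l k))" "l1_norm N l = 2 * real (\<Sum>k\<le>N. nat (- l k))"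
    using 2 by (simp_all only: of_nat_sum[symmetric])
qed

lemma toric_binomial:
  fixes \<alpha> :: "nat \<Rightarrow> 'k::field"
  assumes l: "l \<in> toric_module N n a" "l1_norm N l \<le> 2 * real D"
    and \<alpha>: "\<And>k. k \<le> N \<Longrightarrow> \<alpha> k \<noteq> 0"
  shows "\<exists>f\<in>forms N D. \<forall>x. (\<forall>k\<le>N. x k \<noteq> 0) \<longrightarrow>
    (mpol_eval f x = 0 \<longleftrightarrow> chr N (\<lambda>k. x k / \<alpha> k) l = 1)"
proof -
  have sum0: "(\<Sum>k\<le>N. l k) = 0" using l(1) by (simp add: toric_module_def)
  define h where "h = (\<Sum>k\<le>N. nat (l k))"
  have h: "(\<Sum>k\<le>N. nat (- l k)) = h" "h \<le> D"
    using l1_norm_even[OF sum0] l(2) unfolding h_def by linarith+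
  \<comment> \<open>\<open>p 1\<close> and \<open>p (- 1)\<close> are the positive and the negative
    part of \<open>l\<close>, both padded at index 0 to reach degree \<open>D\<close>. The extra
    power of the zeroth coordinate is invisible on the torus.\<close>
  define p where "p = (\<lambda>s k. nat (s * l k) + (if k = 0 then D - h else 0))"
  have p: "(\<Sum>k\<le>N. p s k) = D" if "s \<in> {1, -1}" for s
    using that h by (auto simp: p_def sum.distrib h_def[symmetric] sum.delta)
  have diff: "int (p 1 k) - int (p (- 1) k) = l k" for k by (auto simp: p_def)
  let ?m = "\<lambda>s. exponent N (p s)"
  define f where "f = Poly_Mapping.single (?m 1) (monom_eval \<alpha> (?m (-1))) +
      Poly_Mapping.single (?m (-1)) (- monom_eval \<alpha> (?m 1))"
  have "f \<in> forms N D"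
    unfolding f_def by (intro forms_add exponent_in_forms p) auto
  moreover have "mpol_eval f x = 0 \<longleftrightarrow> chr N (\<lambda>k. x k / \<alpha> k) l = 1" if x: "\<forall>k\<le>N. x k \<noteq> 0" for x
  proof -
    have me: "monom_eval y (?m s) = chr N y (\<lambda>k. int (p s k))" for y s
      by (simp add: monom_eval_chr[OF keys_exponent] lookup_exponent chr_def)
    have eq: "chr N (\<lambda>k. x k / \<alpha> k) l =
        chr N (\<lambda>k. x k / \<alpha> k) (\<lambda>k. int (p 1 k)) / chr N (\<lambda>k. x k / \<alpha> k) (\<lambda>k. int (p (-1) k))"
      using x \<alpha> by (subst chr_diff[symmetric]) (auto simp: diff)
    show ?thesis
      using chr_nonzero[of N x] chr_nonzero[of N \<alpha>] x \<alpha> unfolding eq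
      by (simp add: f_def mpol_eval_add mpol_eval_single me chr_divide field_simps)
  qed
  ultimately show ?thesis by blast
qed

section \<open>Torus points and their coordinate vectors\<close>

definition torus_vec :: "nat \<Rightarrow> (nat \<Rightarrow> 'k::field) set" where
  "torus_vec N = {x. (\<forall>k\<le>N. x k \<noteq> 0) \<and> (\<forall>k>N. x k = 0)}"

lemma torus_vec_hom_coords: "x \<in> torus_vec N \<Longrightarrow> x \<in> hom_coords N"
  by (auto simp: torus_vec_def hom_coords_def)

lemma self_in_pt: "x \<in> pt x"
  unfolding pt_def by (intro CollectI exI[of _ 1]) simp

lemma pt_eqI:
  assumes "y \<in> pt x" shows "pt y = pt x"
proof -
  obtain c where c: "c \<noteq> 0" "y = (\<lambda>j. c * x j)" using assms by (auto simp: pt_def)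
  have "\<exists>d. d \<noteq> 0 \<and> z = (\<lambda>j. d * x j)" if "d \<noteq> 0" "z = (\<lambda>j. d * y j)" for d z
    using that c by (intro exI[of _ "d * c"]) (simp add: mult.assoc)
  moreover have "\<exists>d. d \<noteq> 0 \<and> z = (\<lambda>j. d * y j)" if "d \<noteq> 0" "z = (\<lambda>j. d * x j)" for d z
    using that c by (intro exI[of _ "d / c"]) simp
  ultimately show ?thesis unfolding pt_def by blast
qed

lemma pt_in_proj_torus:
  assumes "x \<in> torus_vec N" shows "pt x \<in> proj_torus N"
proof -
  have "(\<Prod>j\<le>N. x j) \<noteq> 0" using assms by (auto simp: torus_vec_def)
  then show ?thesis
    using torus_vec_hom_coords[OF assms] self_in_pt[of x]
    by (auto simp: proj_torus_def proj_space_def)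
qed

lemma proj_torus_normalized:
  assumes "P \<in> proj_torus N"
  shows "\<exists>x\<in>torus_vec N. x 0 = 1 \<and> P = pt x"
proof -
  obtain z where z: "z \<in> hom_coords N" "P = pt z"
    using assms by (auto simp: proj_torus_def proj_space_def)
  then obtain y where y: "y \<in> pt z" "(\<Prod>j\<le>N. y j) \<noteq> 0"
    using assms by (auto simp: proj_torus_def)
  then obtain c where "c \<noteq> 0" "y = (\<lambda>j. c * z j)" by (auto simp: pt_def)
  then have nz: "z k \<noteq> 0" if "k \<le> N" for k using y(2) that by auto
  define x where "x = (\<lambda>j. (1 / z 0) * z j)"
  have "x \<in> pt z" unfolding pt_def x_def using nz[of 0] by (intro CollectI exI[of _ "1 / z 0"]) simp
  then have "P = pt x" using pt_eqI z(2) by blast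
  moreover have "x \<in> torus_vec N" using nz z(1) by (auto simp: torus_vec_def x_def hom_coords_def)
  moreover have "x 0 = 1" using nz by (simp add: x_def)
  ultimately show ?thesis by blast
qed

definition vanishes :: "'k::field mpol \<Rightarrow> 'k ppoint set \<Rightarrow> bool" where
  "vanishes f A \<longleftrightarrow> (\<forall>P\<in>A. \<forall>x\<in>P. mpol_eval f x = 0)"

lemma form_zero_on_pt:
  assumes "f \<in> forms N D"
  shows "(\<forall>y\<in>pt x. mpol_eval f y = 0) \<longleftrightarrow> mpol_eval f x = 0"
  using self_in_pt[of x] mpol_eval_scale[OF assms] by (auto simp: pt_def)

lemma toric_vec_in_torus:
  assumes "\<forall>i\<le>N. \<alpha> i \<noteq> 0" "\<forall>j<n. s j \<noteq> 0"
  shows "toric_vec N n a \<alpha> s \<in> torus_vec N"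
  using assms by (auto simp: torus_vec_def toric_vec_def)

lemma vanishing_ideal_toric_variety:
  assumes \<alpha>: "\<forall>i\<le>N. \<alpha> i \<noteq> 0" and f: "f \<in> forms N D"
  shows "f \<in> vanishing_ideal N (toric_variety N n a \<alpha>) \<longleftrightarrow>
    (\<forall>s. (\<forall>j<n. s j \<noteq> 0) \<longrightarrow> mpol_eval f (toric_vec N n a \<alpha> s) = 0)" (is "?L \<longleftrightarrow> ?R")
proof -
  let ?I = "toric_map N n a \<alpha> ` {s. \<forall>j<n. s j \<noteq> 0}"
  have tm: "toric_map N n a \<alpha> s = pt (toric_vec N n a \<alpha> s)" for s
    by (simp add: toric_map_def toric_vec_def)
  have I: "?I \<subseteq> proj_space N"
    unfolding tm proj_space_def
    using torus_vec_hom_coords[OF toric_vec_in_torus[OF \<alpha>]] by blast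
  show ?thesis
  proof
    assume ?L
    moreover have "?I \<subseteq> toric_variety N n a \<alpha>"
      unfolding toric_variety_def using I by (intro closure_of_subset) (simp add: topspace_zariski)
    ultimately show ?R
      using self_in_pt[of "toric_vec N n a \<alpha> _"] unfolding vanishing_ideal_def tm
      by (auto simp: subset_iff)
  next
    assume ?R
    then have "?I \<subseteq> proj_zeros N {f}"
      using I form_zero_on_pt[OF f] by (auto simp: proj_zeros_def tm)
    moreover have "closedin (zariski N) (proj_zeros N {f})"
      unfolding closedin_zariski using f by (intro exI[of _ "{f}"]) auto
    ultimately have "toric_variety N n a \<alpha> \<subseteq> proj_zeros N {f}"
      unfolding toric_variety_def by (rule closure_of_minimal)
    then show ?L using f by (auto simp: vanishing_ideal_def forms_def proj_zeros_def)
  qed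
qed

lemma pt_in_toric_locus_iff:
  fixes \<alpha> :: "nat \<Rightarrow> 'k::alg_closed_field"
  assumes \<alpha>: "\<forall>i\<le>N. \<alpha> i \<noteq> 0" and x: "x \<in> torus_vec N"
  shows "pt x \<in> proj_zeros N (vanishing_ideal N (toric_variety N n a \<alpha>) \<inter> forms N D) \<inter> proj_torus N
    \<longleftrightarrow> (\<forall>l\<in>toric_module N n a. l1_norm N l \<le> 2 * real D \<longrightarrow> chr N (\<lambda>k. x k / \<alpha> k) l = 1)"
    (is "?L \<longleftrightarrow> ?R")
proof -
  have x': "\<forall>k\<le>N. x k \<noteq> 0" using x by (simp add: torus_vec_def)
  have "pt x \<in> proj_space N" using torus_vec_hom_coords[OF x] by (simp add: proj_space_def)
  then have L: "?L \<longleftrightarrow> (\<forall>f\<in>forms N D. (\<forall>s. (\<forall>j<n. s j \<noteq> 0) \<longrightarrow> mpol_eval f (toric_vec N n a \<alpha> s) = 0)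
      \<longrightarrow> mpol_eval f x = 0)"
    using pt_in_proj_torus[OF x] form_zero_on_pt[of _ N D x]
      vanishing_ideal_toric_variety[OF \<alpha>, of _ D n a]
    unfolding proj_zeros_def by blast
  show ?thesis
    unfolding L
  proof (intro iffI ballI impI)
    fix l
    assume H: "\<forall>f\<in>forms N D. (\<forall>s. (\<forall>j<n. s j \<noteq> 0) \<longrightarrow> mpol_eval f (toric_vec N n a \<alpha> s) = 0)
        \<longrightarrow> mpol_eval f x = 0"
      and l: "l \<in> toric_module N n a" "l1_norm N l \<le> 2 * real D"
    obtain f where f: "f \<in> forms N D" "\<And>x. (\<forall>k\<le>N. x k \<noteq> 0) \<Longrightarrow>
        (mpol_eval f x = 0 \<longleftrightarrow> chr N (\<lambda>k. x k / \<alpha> k) l = 1)"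
      using toric_binomial[OF l, of \<alpha>] \<alpha> by blast
    have "mpol_eval f (toric_vec N n a \<alpha> s) = 0" if s: "\<forall>j<n. s j \<noteq> 0" for s
    proof -
      have "chr N (\<lambda>k. toric_vec N n a \<alpha> s k / \<alpha> k) l = chr N (\<lambda>i. \<Prod>j<n. s j powi a i j) l"
        unfolding chr_def using \<alpha> by (intro prod.cong) (auto simp: toric_vec_def)
      also have "\<dots> = 1"
        using s l(1) by (subst chr_monomial_point) (auto simp: toric_module_def)
      finally show ?thesis
        using f(2) toric_vec_in_torus[OF \<alpha> s] by (auto simp: torus_vec_def)
    qed
    then show "chr N (\<lambda>k. x k / \<alpha> k) l = 1" using H f x' by blast
  next
    fix f
    assume H: ?R and f: "f \<in> forms N D"
      "\<forall>s. (\<forall>j<n. s j \<noteq> 0) \<longrightarrow> mpol_eval f (toric_vec N n a \<alpha> s) = 0"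
    show "mpol_eval f x = 0"
    proof (rule toric_form_vanishes[OF infinite_UNIV_alg_closed f(1)])
      show "mpol_eval f (toric_vec N n a \<alpha> s) = 0" if "\<forall>j<n. s j \<noteq> 0" for s
        using f(2) that by blast
      show "chr N (\<lambda>k. x k / \<alpha> k) l = 1" if "l \<in> toric_module N n a" "l1_norm N l \<le> 2 * real D" for l
        using H that by blast
    qed (use \<alpha> x' in blast)+
  qed
qed

section \<open>Irreducible subsets and forms\<close>

lemma topspace_subtopology_zariski:
  "Z \<subseteq> proj_space N \<Longrightarrow> topspace (subtopology (zariski N) Z) = Z"
  by (auto simp: topspace_zariski)

lemma vanishes_at_rep:
  assumes "f \<in> forms N D" "P \<in> proj_space N" "x \<in> P" "mpol_eval f x = 0" "y \<in> P"
  shows "mpol_eval f y = 0"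
  using form_nonzero_on_point[OF assms(1,2,5,3)] assms(4) by blast

text \<open>For forms one representative per point is enough, which lets the condition be checked on
  normalised vectors.\<close>

lemma irreducible_spaceD:
  assumes irr: "irreducible_space (subtopology (zariski N) Z)" and Z: "Z \<subseteq> proj_space N"
    and f: "f \<in> forms N D" and g: "g \<in> forms N E"
    and fg: "\<And>P. P \<in> Z \<Longrightarrow> \<exists>x\<in>P. mpol_eval f x * mpol_eval g x = 0"
  shows "vanishes f Z \<or> vanishes g Z"
proof -
  have cl: "closedin (subtopology (zariski N) Z) (proj_zeros N {h} \<inter> Z)" if "h \<in> forms N E" for h E
    unfolding closedin_subtopology closedin_zariski using that
    by (intro exI[of _ "proj_zeros N {h}"] conjI exI[of _ "{h}"]) auto
  have "Z = (proj_zeros N {f} \<inter> Z) \<union> (proj_zeros N {g} \<inter> Z)"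
  proof (intro equalityI subsetI)
    fix P assume P: "P \<in> Z"
    then obtain x where x: "x \<in> P" "mpol_eval f x = 0 \<or> mpol_eval g x = 0"
      using fg by fastforce
    then show "P \<in> (proj_zeros N {f} \<inter> Z) \<union> (proj_zeros N {g} \<inter> Z)"
      using vanishes_at_rep[OF f _ x(1)] vanishes_at_rep[OF g _ x(1)] P Z
      by (auto simp: proj_zeros_def)
  qed auto
  then have "proj_zeros N {f} \<inter> Z = Z \<or> proj_zeros N {g} \<inter> Z = Z"
    using irr cl[OF f] cl[OF g]
    unfolding irreducible_space_def topspace_subtopology_zariski[OF Z] by blast
  then show ?thesis by (auto simp: vanishes_def proj_zeros_def)
qed

lemma irreducible_spaceI:
  assumes Z: "Z \<subseteq> proj_space N" "Z \<noteq> {}"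
    and prime: "\<And>f g D E. f \<in> forms N D \<Longrightarrow> g \<in> forms N E \<Longrightarrow>
      \<forall>P\<in>Z. \<forall>x\<in>P. mpol_eval f x * mpol_eval g x = 0 \<Longrightarrow> vanishes f Z \<or> vanishes g Z"
  shows "irreducible_space (subtopology (zariski N) Z)"
  unfolding irreducible_space_def topspace_subtopology_zariski[OF Z(1)]
proof (intro conjI allI impI Z(2))
  fix C D
  assume "closedin (subtopology (zariski N) Z) C \<and> closedin (subtopology (zariski N) Z) D \<and> Z = C \<union> D"
  then obtain S T where S: "S \<subseteq> (\<Union>d. forms N d)" "C = proj_zeros N S \<inter> Z"
    and T: "T \<subseteq> (\<Union>d. forms N d)" "D = proj_zeros N T \<inter> Z" and ZCD: "Z = C \<union> D"
    unfolding closedin_subtopology closedin_zariski by blast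
  show "C = Z \<or> D = Z"
  proof (rule ccontr)
    assume "\<not> (C = Z \<or> D = Z)"
    then obtain P P' where P: "P \<in> Z" "P \<notin> proj_zeros N S" "P' \<in> Z" "P' \<notin> proj_zeros N T"
      using S(2) T(2) by blast
    then obtain f g where f: "f \<in> S" "\<not> vanishes f Z" and g: "g \<in> T" "\<not> vanishes g Z"
      using Z(1) unfolding proj_zeros_def vanishes_def by blast
    have "mpol_eval f x * mpol_eval g x = 0" if "R \<in> Z" "x \<in> R" for R x
    proof -
      have "R \<in> proj_zeros N S \<or> R \<in> proj_zeros N T" using that(1) ZCD S(2) T(2) by blast
      then show ?thesis using f(1) g(1) that(2) by (auto simp: proj_zeros_def)
    qed
    then have fg: "\<forall>P\<in>Z. \<forall>x\<in>P. mpol_eval f x * mpol_eval g x = 0" by blast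
    obtain d e where "f \<in> forms N d" "g \<in> forms N e" using f(1) g(1) S(1) T(1) by blast
    from prime[OF this fg] show False using f(2) g(2) by blast
  qed
qed

lemma closed_separating_form:
  assumes "closedin (subtopology (zariski N) S) Z" "Z \<subset> Z'" "Z' \<subseteq> S" "S \<subseteq> proj_space N"
  shows "\<exists>D. \<exists>f\<in>forms N D. vanishes f Z \<and> \<not> vanishes f Z'"
proof -
  obtain F where F: "F \<subseteq> (\<Union>d. forms N d)" "Z = proj_zeros N F \<inter> S"
    using assms(1) unfolding closedin_subtopology closedin_zariski by blast
  obtain P where "P \<in> Z'" "P \<notin> Z" using assms(2) by blast
  then obtain f x where f: "f \<in> F" "x \<in> P" "mpol_eval f x \<noteq> 0"
    using assms(3,4) F(2) unfolding proj_zeros_def by blast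
  then have "vanishes f Z" "\<not> vanishes f Z'"
    using F(2) \<open>P \<in> Z'\<close> by (auto simp: vanishes_def proj_zeros_def)
  then show ?thesis using f(1) F(1) by blast
qed

section \<open>Polynomial functions in the chart where the zeroth coordinate is one\<close>

text \<open>Dehomogenisation: where \<open>x 0 = 1\<close>, forms of degree \<open>D\<close> become
  polynomials of degree at most \<open>D\<close>. The bound can be raised by powers of the zeroth
  variable, so functions coming from forms of different degrees can be added.\<close>

definition polyfun :: "nat \<Rightarrow> nat \<Rightarrow> ((nat \<Rightarrow> 'k::field) \<Rightarrow> 'k) \<Rightarrow> bool" where
  "polyfun N D h \<longleftrightarrow> (\<exists>f\<in>forms N D. \<forall>x. x 0 = 1 \<longrightarrow> mpol_eval f x = h x)"

lemma polyfun_form: "f \<in> forms N D \<Longrightarrow> polyfun N D (mpol_eval f)"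
  by (auto simp: polyfun_def)

lemma polyfun_add: "polyfun N D g \<Longrightarrow> polyfun N D h \<Longrightarrow> polyfun N D (\<lambda>x. g x + h x)"
  unfolding polyfun_def by (metis forms_add mpol_eval_add)

lemma polyfun_mult: "polyfun N D g \<Longrightarrow> polyfun N E h \<Longrightarrow> polyfun N (D + E) (\<lambda>x. g x * h x)"
  unfolding polyfun_def by (metis forms_mult mpol_eval_mult)

lemma polyfun_const: "polyfun N 0 (\<lambda>_. c)"
  unfolding polyfun_def using const_in_forms[of c N]
  by (intro bexI[of _ "Poly_Mapping.single 0 c"]) (auto simp: mpol_eval_single monom_eval_def)

lemma polyfun_one: "polyfun N D (\<lambda>_. 1)"
proof -
  let ?f = "Poly_Mapping.single (Poly_Mapping.single 0 D) 1 :: 'a mpol"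
  have "?f \<in> forms N D"
    by (rule single_in_forms) (auto simp: lookup_single when_def sum.delta split: if_splits)
  moreover have "mpol_eval ?f x = 1" if "x 0 = 1" for x
    using that by (auto simp: mpol_eval_single monom_eval_def intro!: prod.neutral split: if_splits)
  ultimately show ?thesis by (auto simp: polyfun_def)
qed

lemma polyfun_mono: "polyfun N D h \<Longrightarrow> D \<le> E \<Longrightarrow> polyfun N E h"
  using polyfun_mult[of N D h "E - D" "\<lambda>_. 1", OF _ polyfun_one] by simp

lemma polyfun_power: "polyfun N D h \<Longrightarrow> polyfun N (D * b) (\<lambda>x. h x ^ b)"
proof (induction b)
  case (Suc b)
  then show ?case using polyfun_mult[of N D h "D * b" "\<lambda>x. h x ^ b"] by simp
qed (use polyfun_const[of N 1] in simp)

definition regular :: "nat \<Rightarrow> ((nat \<Rightarrow> 'k::field) \<Rightarrow> 'k) \<Rightarrow> bool" where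
  "regular N h \<longleftrightarrow> (\<exists>D. polyfun N D h)"

lemma regular_add:
  assumes "regular N g" "regular N h" shows "regular N (\<lambda>x. g x + h x)"
proof -
  obtain D E where "polyfun N D g" "polyfun N E h" using assms by (auto simp: regular_def)
  then have "polyfun N (D + E) g" "polyfun N (D + E) h" by (auto intro: polyfun_mono)
  then show ?thesis unfolding regular_def using polyfun_add by blast
qed

lemma regular_mult: "regular N g \<Longrightarrow> regular N h \<Longrightarrow> regular N (\<lambda>x. g x * h x)"
  unfolding regular_def using polyfun_mult by blast

lemma regular_const: "regular N (\<lambda>_. c)"
  unfolding regular_def using polyfun_const by blast

lemma regular_power: "regular N h \<Longrightarrow> regular N (\<lambda>x. h x ^ b)"
  unfolding regular_def using polyfun_power by blast

lemma regular_sum: "(\<And>a. a \<in> A \<Longrightarrow> regular N (h a)) \<Longrightarrow> regular N (\<lambda>x. \<Sum>a\<in>A. h a x)"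
  by (induction A rule: infinite_finite_induct) (auto simp: regular_const regular_add)

definition chart :: "nat \<Rightarrow> 'k::field ppoint set \<Rightarrow> (nat \<Rightarrow> 'k) set" where
  "chart N Z = {x \<in> torus_vec N. x 0 = 1 \<and> pt x \<in> Z}"

lemma proj_torus_subset: "proj_torus N \<subseteq> proj_space N"
  by (auto simp: proj_torus_def)

lemma chart_rep:
  assumes "Z \<subseteq> proj_torus N" "P \<in> Z"
  shows "\<exists>x\<in>chart N Z. P = pt x"
proof -
  obtain x where "x \<in> torus_vec N" "x 0 = 1" "P = pt x"
    using proj_torus_normalized[of P N] assms by blast
  then show ?thesis using assms(2) by (auto simp: chart_def)
qed

lemma vanishes_chart:
  assumes f: "f \<in> forms N D" and Z: "Z \<subseteq> proj_torus N"
  shows "vanishes f Z \<longleftrightarrow> (\<forall>x\<in>chart N Z. mpol_eval f x = 0)"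
proof
  assume "vanishes f Z"
  then show "\<forall>x\<in>chart N Z. mpol_eval f x = 0"
    using self_in_pt by (auto simp: vanishes_def chart_def)
next
  assume H: "\<forall>x\<in>chart N Z. mpol_eval f x = 0"
  show "vanishes f Z"
    unfolding vanishes_def
  proof
    fix P assume "P \<in> Z"
    then obtain x where "x \<in> chart N Z" "P = pt x" using chart_rep[OF Z] by blast
    then show "\<forall>x\<in>P. mpol_eval f x = 0" using form_zero_on_pt[OF f, of x] H by simp
  qed
qed

text \<open>The functions on an irreducible set form an integral domain; \<open>g\<close> can be
  cancelled because it is nonzero at \<open>x0\<close>.\<close>

lemma irreducible_regular:
  assumes irr: "irreducible_space (subtopology (zariski N) Z)" and Z: "Z \<subseteq> proj_torus N"
    and gh: "regular N g" "regular N h" and zero: "\<And>x. x \<in> chart N Z \<Longrightarrow> g x * h x = 0"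
    and x0: "x0 \<in> chart N Z" "g x0 \<noteq> 0" and x: "x \<in> chart N Z"
  shows "h x = 0"
proof -
  obtain D E f k where f: "f \<in> forms N D" "\<And>x. x 0 = 1 \<Longrightarrow> mpol_eval f x = g x"
    and k: "k \<in> forms N E" "\<And>x. x 0 = 1 \<Longrightarrow> mpol_eval k x = h x"
    using gh by (auto simp: regular_def polyfun_def)
  have "vanishes f Z \<or> vanishes k Z"
  proof (rule irreducible_spaceD[OF irr _ f(1) k(1)])
    show "Z \<subseteq> proj_space N" using Z proj_torus_subset by blast
    fix P assume "P \<in> Z"
    then obtain x where x: "x \<in> chart N Z" "P = pt x" using chart_rep[OF Z] by blast
    then have "mpol_eval f x * mpol_eval k x = 0"
      using zero[OF x(1)] f(2)[of x] k(2)[of x] by (simp add: chart_def)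
    then show "\<exists>x\<in>P. mpol_eval f x * mpol_eval k x = 0" using x(2) self_in_pt by blast
  qed
  moreover have "\<not> vanishes f Z"
    using x0 f(2)[of x0] vanishes_chart[OF f(1) Z] by (auto simp: chart_def)
  ultimately show ?thesis
    using vanishes_chart[OF k(1) Z] k(2)[of x] x by (auto simp: chart_def)
qed

section \<open>Algebraic independence along a chain\<close>

text \<open>The head of the list is the exponent of the function with the highest index. Removing it
  leaves a product of the remaining functions, which matches the induction along the chain.\<close>

fun power_product :: "(nat \<Rightarrow> 'x \<Rightarrow> 'k::comm_semiring_1) \<Rightarrow> nat list \<Rightarrow> 'x \<Rightarrow> 'k" where
  "power_product \<phi> [] = (\<lambda>x. 1)"
| "power_product \<phi> (b # bs) = (\<lambda>x. \<phi> (length bs) x ^ b * power_product \<phi> bs x)"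

definition exponent_lists :: "nat \<Rightarrow> nat \<Rightarrow> nat list set" where
  "exponent_lists B m = {bs. set bs \<subseteq> {..B} \<and> length bs = m}"

lemma finite_exponent_lists: "finite (exponent_lists B m)"
  by (simp add: exponent_lists_def finite_lists_length_eq)

lemma card_exponent_lists: "card (exponent_lists B m) = Suc B ^ m"
  by (simp add: exponent_lists_def card_lists_length_eq)

lemma sum_exponent_lists_Suc:
  "(\<Sum>bs\<in>exponent_lists B (Suc m). F bs) = (\<Sum>b\<le>B. \<Sum>bs\<in>exponent_lists B m. F (b # bs))"
proof -
  have "exponent_lists B (Suc m) = (\<lambda>(b, bs). b # bs) ` ({..B} \<times> exponent_lists B m)"
    by (auto simp: exponent_lists_def length_Suc_conv image_iff)
  moreover have "inj_on (\<lambda>(b, bs). b # bs) ({..B} \<times> exponent_lists B m)"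
    by (auto simp: inj_on_def)
  ultimately show ?thesis
    by (simp add: sum.reindex sum.cartesian_product case_prod_unfold)
qed

lemma regular_power_product:
  "(\<And>j. j < length bs \<Longrightarrow> regular N (\<phi> j)) \<Longrightarrow> regular N (power_product \<phi> bs)"
proof (induction bs)
  case (Cons b bs)
  then show ?case
    using regular_mult[OF regular_power[of N "\<phi> (length bs)" b], of "power_product \<phi> bs"] by simp
qed (simp add: regular_const)

lemma polyfun_power_product:
  assumes "\<And>j. j < length bs \<Longrightarrow> polyfun N d (\<phi> j)" "set bs \<subseteq> {..B}"
  shows "polyfun N (d * B * length bs) (power_product \<phi> bs)"
  using assms
proof (induction bs)
  case (Cons b bs)
  have "polyfun N (d * b + d * B * length bs) (\<lambda>x. \<phi> (length bs) x ^ b * power_product \<phi> bs x)"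
    using Cons by (intro polyfun_mult polyfun_power) auto
  then have "polyfun N (d * B * length (b # bs)) (\<lambda>x. \<phi> (length bs) x ^ b * power_product \<phi> bs x)"
    by (rule polyfun_mono) (use Cons.prems(2) in auto)
  then show ?case by simp
qed (use polyfun_const[of N 1] in simp)

text \<open>If \<open>\<phi> j\<close> vanishes on the \<open>j\<close>-th member of the chain but not on the next one, then
  \<open>\<phi> 0, \<dots>, \<phi> (m - 1)\<close> are algebraically independent on the \<open>m\<close>-th: cancel the lowest power of
  \<open>\<phi> (m - 1)\<close> from a relation, which is possible by irreducibility, and restrict to the previous
  member of the chain.\<close>

lemma chain_independent:
  fixes Z :: "nat \<Rightarrow> 'k::field ppoint set"
  assumes Z: "\<And>j. j \<le> m \<Longrightarrow> Z j \<subseteq> proj_torus N"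
    and irr: "\<And>j. j \<le> m \<Longrightarrow> irreducible_space (subtopology (zariski N) (Z j))"
    and sub: "\<And>j. j < m \<Longrightarrow> Z j \<subseteq> Z (Suc j)"
    and reg: "\<And>j. j < m \<Longrightarrow> regular N (\<phi> j)"
    and zero: "\<And>j x. j < m \<Longrightarrow> x \<in> chart N (Z j) \<Longrightarrow> \<phi> j x = 0"
    and nz: "\<And>j. j < m \<Longrightarrow> \<exists>x\<in>chart N (Z (Suc j)). \<phi> j x \<noteq> 0"
    and rel: "\<And>x. x \<in> chart N (Z m) \<Longrightarrow>
      (\<Sum>bs\<in>exponent_lists B m. c bs * power_product \<phi> bs x) = 0"
  shows "\<forall>bs\<in>exponent_lists B m. c bs = 0"
  using assms
proof (induction m arbitrary: c)
  case 0
  have "Z 0 \<noteq> {}"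
    using 0(2)[of 0] by (auto simp: irreducible_space_def)
  then obtain x where "x \<in> chart N (Z 0)" using chart_rep 0(1)[of 0] by blast
  moreover have "exponent_lists B 0 = {[]}" by (auto simp: exponent_lists_def)
  ultimately show ?case using 0(7) by fastforce
next
  case (Suc m)
  let ?L = "exponent_lists B m"
  define H where "H = (\<lambda>b x. \<Sum>bs\<in>?L. c (b # bs) * power_product \<phi> bs x)"
  have regH: "regular N (H b)" for b
    unfolding H_def using Suc.prems(4)
    by (intro regular_sum regular_mult regular_const regular_power_product)
      (auto simp: exponent_lists_def)
  have rel: "(\<Sum>b\<le>B. \<phi> m x ^ b * H b x) = 0" if "x \<in> chart N (Z (Suc m))" for x
  proof -
    have "(\<Sum>b\<le>B. \<phi> m x ^ b * H b x) =
        (\<Sum>b\<le>B. \<Sum>bs\<in>?L. c (b # bs) * power_product \<phi> (b # bs) x)"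
      unfolding H_def sum_distrib_left by (intro sum.cong refl) (auto simp: exponent_lists_def)
    then show ?thesis using Suc.prems(7)[OF that] by (simp only: sum_exponent_lists_Suc)
  qed
  obtain x0 where x0: "x0 \<in> chart N (Z (Suc m))" "\<phi> m x0 \<noteq> 0" using Suc.prems(6) by blast
  have "b \<le> B \<longrightarrow> (\<forall>bs\<in>?L. c (b # bs) = 0)" for b
  proof (induction b rule: less_induct)
    case (less b)
    show ?case
    proof
      assume b: "b \<le> B"
      have H0: "H b' x = 0" if "b' < b" for b' x
        using less.IH[OF that] that b by (simp add: H_def)
      define R where "R = (\<lambda>x. \<Sum>b'\<in>{b..B}. \<phi> m x ^ (b' - b) * H b' x)"
      have "regular N R"
        unfolding R_def using Suc.prems(4)
        by (intro regular_sum regular_mult regular_power regH) auto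
      have fac: "\<phi> m x ^ b * R x = 0" if "x \<in> chart N (Z (Suc m))" for x
      proof -
        have "\<phi> m x ^ b * R x = (\<Sum>b'\<in>{b..B}. \<phi> m x ^ b' * H b' x)"
          unfolding R_def sum_distrib_left
          by (intro sum.cong refl) (simp add: mult.assoc[symmetric] power_add[symmetric])
        also have "\<dots> = (\<Sum>b'\<le>B. \<phi> m x ^ b' * H b' x)"
          using H0 by (intro sum.mono_neutral_left) (auto simp: not_le)
        finally show ?thesis using rel[OF that] by simp
      qed
      have R0: "R x = 0" if "x \<in> chart N (Z (Suc m))" for x
      proof (rule irreducible_regular[of N "Z (Suc m)" "\<lambda>x. \<phi> m x ^ b" R x0 x])
        show "regular N (\<lambda>x. \<phi> m x ^ b)" using Suc.prems(4) by (intro regular_power) auto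
      qed (use Suc.prems(1,2) \<open>regular N R\<close> fac x0 that in auto)
      have "H b x = 0" if x: "x \<in> chart N (Z m)" for x
      proof -
        have "x \<in> chart N (Z (Suc m))" using x Suc.prems(3)[of m] by (auto simp: chart_def)
        \<comment> \<open>\<open>\<phi> m\<close> is zero on the previous member of the chain, so
          only the term with exponent zero survives.\<close>
        moreover have "R x = (\<Sum>b'\<in>{b..B}. if b' = b then H b x else 0)"
          unfolding R_def using Suc.prems(5)[OF _ x] by (intro sum.cong refl) auto
        ultimately show ?thesis using R0 b by simp
      qed
      then have "\<forall>bs\<in>?L. c (b # bs) = 0"
        using Suc.prems by (intro Suc.IH) (auto simp: H_def)
      then show "\<forall>bs\<in>?L. c (b # bs) = 0" .
    qed
  qed
  then show ?case
    by (auto simp: exponent_lists_def length_Suc_conv)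
qed

section \<open>Growth of monomials modulo a lattice\<close>

lemma int_div_abs_le:
  fixes z q :: int
  assumes "q > 0" "z \<ge> 0"
  shows "\<bar>z div q\<bar> \<le> z"
  using assms zdiv_mono2[of z 1 q] by (simp add: pos_imp_zdiv_nonneg_iff)

text \<open>Subtracting multiples of the pivot rows turns the \<open>i\<close> pivot entries into
  residues modulo \<open>q\<close>, which gives the constant \<open>Q\<close>. The other entries
  stay of order \<open>D\<close>, and the one at \<open>k0\<close> is recovered from the total
  degree, which leaves \<open>N - i\<close> free ones. Equal labels put the difference in the
  lattice, but congruent exponents need not share a label: the pivot rows may generate a smaller
  lattice.\<close>

lemma lattice_classes:
  assumes li: "lin_indep_family i v" and supp: "\<And>l k. l < i \<Longrightarrow> k > N \<Longrightarrow> v l k = 0"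
    and sum0: "\<And>l. l < i \<Longrightarrow> (\<Sum>k\<le>N. v l k) = 0" and iN: "i \<le> N"
  shows "\<exists>Q C :: nat. \<forall>D. \<exists>(K :: (nat \<Rightarrow> int) set) \<kappa>. finite K \<and> card K \<le> Q * (C * D + 1) ^ (N - i) \<and>
    (\<forall>u. (\<Sum>k\<le>N. u k) = D \<and> (\<forall>k>N. u k = 0) \<longrightarrow> \<kappa> u \<in> K) \<and>
    (\<forall>u u'. (\<Sum>k\<le>N. u k) = D \<and> (\<forall>k>N. u k = 0) \<and> (\<Sum>k\<le>N. u' k) = D \<and> (\<forall>k>N. u' k = 0) \<and>
      \<kappa> u = \<kappa> u' \<longrightarrow> (\<lambda>k. int (u k) - int (u' k)) \<in> int_span i v)"
proof -
  obtain J q \<mu> where e: "echelon N i v J q \<mu>" using echelon_exists[OF li supp] by blast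
  have J: "J \<subseteq> {..N}" "card J = i" and q: "q > 0"
    and sp: "\<And>j. j \<in> J \<Longrightarrow> \<mu> j \<in> int_span i v"
    and mu: "\<And>j j'. j \<in> J \<Longrightarrow> j' \<in> J \<Longrightarrow> \<mu> j j' = (if j' = j then q else 0)"
    using e by (auto simp: echelon_def)
  have fin: "finite J" using J(1) finite_subset by blast
  have "{..N} - J \<noteq> {}" using J iN card_mono[of J "{..N}"] fin by fastforce
  then obtain k0 where k0: "k0 \<le> N" "k0 \<notin> J" by blast
  have mu0: "(\<Sum>k\<le>N. \<mu> j k) = 0" "k > N \<Longrightarrow> \<mu> j k = 0" if j: "j \<in> J" for j k
  proof -
    obtain c where c: "\<forall>k. \<mu> j k = (\<Sum>l<i. c l * v l k)" using sp[OF j] by (auto simp: int_span_def)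
    have "(\<Sum>k\<le>N. \<mu> j k) = (\<Sum>l<i. c l * (\<Sum>k\<le>N. v l k))"
      unfolding c[rule_format] sum_distrib_left by (rule sum.swap)
    then show "(\<Sum>k\<le>N. \<mu> j k) = 0" using sum0 by simp
    show "k > N \<Longrightarrow> \<mu> j k = 0" using c supp by simp
  qed
  define A where "A = 1 + (\<Sum>j\<in>J. \<Sum>k\<le>N. \<bar>\<mu> j k\<bar>)"
  have A: "A \<ge> 1" unfolding A_def by (simp add: sum_nonneg)
  define red where "red = (\<lambda>(u :: nat \<Rightarrow> nat) k. int (u k) - (\<Sum>j\<in>J. (int (u j) div q) * \<mu> j k))"
  define I where "I = {..N} - {k0}"
  define \<kappa> where "\<kappa> = (\<lambda>u. restrict (red u) I)"
  define K where "K = (\<lambda>D :: nat. \<Pi>\<^sub>E k\<in>I. if k \<in> J then {0..<q} else {- A * int D..A * int D})"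
  have redJ: "red u k = int (u k) mod q" if "k \<in> J" for u k
  proof -
    have "(\<Sum>j\<in>J. (int (u j) div q) * \<mu> j k) = (\<Sum>j\<in>J. if k = j then (int (u j) div q) * q else 0)"
      using mu that by (intro sum.cong) auto
    then show ?thesis using that fin by (simp add: red_def minus_div_mult_eq_mod)
  qed
  have red_bound: "\<bar>red u k\<bar> \<le> A * int D" if u: "(\<Sum>k\<le>N. u k) = D" and k: "k \<le> N" for u k D
  proof -
    have uD: "int (u k) \<le> int D" if "k \<le> N" for k
      using u that member_le_sum[of k "{..N}" u] by simp
    have "\<bar>\<Sum>j\<in>J. (int (u j) div q) * \<mu> j k\<bar> \<le> (\<Sum>j\<in>J. int D * (\<Sum>k\<le>N. \<bar>\<mu> j k\<bar>))"
    proof (rule order_trans[OF sum_abs], rule sum_mono)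
      fix j assume "j \<in> J"
      then have "\<bar>int (u j) div q\<bar> \<le> int D"
        using int_div_abs_le[OF q, of "int (u j)"] uD[of j] J(1) by auto
      moreover have "\<bar>\<mu> j k\<bar> \<le> (\<Sum>k\<le>N. \<bar>\<mu> j k\<bar>)"
        using k by (intro member_le_sum) auto
      ultimately show "\<bar>(int (u j) div q) * \<mu> j k\<bar> \<le> int D * (\<Sum>k\<le>N. \<bar>\<mu> j k\<bar>)"
        unfolding abs_mult by (intro mult_mono) auto
    qed
    moreover have "A * int D = int D + (\<Sum>j\<in>J. int D * (\<Sum>k\<le>N. \<bar>\<mu> j k\<bar>))"
      by (simp add: A_def algebra_simps sum_distrib_left)
    ultimately show ?thesis using uD[OF k] unfolding red_def by linarith
  qed
  have finI: "finite I" by (simp add: I_def)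
  have cardK: "card (K D) \<le> nat q ^ i * (nat (2 * A) * D + 1) ^ (N - i)" for D
  proof -
    have JI: "J \<subseteq> I" using J(1) k0 by (auto simp: I_def)
    have cI: "card (I - J) = N - i" using JI J(2) k0 fin by (simp add: card_Diff_subset I_def)
    have cd: "card {- A * int D..A * int D} = nat (2 * A) * D + 1"
      using A by (simp add: nat_mult_distrib nat_add_distrib algebra_simps)
    have "card (K D) = (\<Prod>k\<in>I. card (if k \<in> J then {0..<q} else {- A * int D..A * int D}))"
      unfolding K_def by (rule card_PiE[OF finI])
    also have "\<dots> = (\<Prod>k\<in>I - J. card (if k \<in> J then {0..<q} else {- A * int D..A * int D})) *
        (\<Prod>k\<in>J. card (if k \<in> J then {0..<q} else {- A * int D..A * int D}))"
      by (rule prod.subset_diff[OF JI finI])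
    also have "(\<Prod>k\<in>J. card (if k \<in> J then {0..<q} else {- A * int D..A * int D})) = nat q ^ i"
      using J(2) by simp
    also have "(\<Prod>k\<in>I - J. card (if k \<in> J then {0..<q} else {- A * int D..A * int D})) =
        (nat (2 * A) * D + 1) ^ (N - i)"
      unfolding cI[symmetric] cd[symmetric] by (simp add: prod_constant)
    finally show ?thesis by simp
  qed
  have finK: "finite (K D)" for D unfolding K_def by (rule finite_PiE[OF finI]) auto
  have inK: "\<kappa> u \<in> K D" if u: "(\<Sum>k\<le>N. u k) = D" for u D
  proof -
    have "red u k \<in> (if k \<in> J then {0..<q} else {- A * int D..A * int D})" if "k \<in> I" for k
      using redJ[of k u] red_bound[OF u, of k] q that by (auto simp: I_def abs_le_iff)
    then show ?thesis unfolding K_def \<kappa>_def by (intro restrict_PiE_iff[THEN iffD2] ballI)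
  qed
  have spanK: "(\<lambda>k. int (u k) - int (u' k)) \<in> int_span i v"
    if u: "(\<Sum>k\<le>N. u k) = D" "\<forall>k>N. u k = 0" and u': "(\<Sum>k\<le>N. u' k) = D" "\<forall>k>N. u' k = 0"
      and eq: "\<kappa> u = \<kappa> u'" for u u' D
  proof -
    have sumred: "(\<Sum>k\<le>N. red u k) = int D" if "(\<Sum>k\<le>N. u k) = D" for u
    proof -
      have "(\<Sum>k\<le>N. \<Sum>j\<in>J. (int (u j) div q) * \<mu> j k) = (\<Sum>j\<in>J. \<Sum>k\<le>N. (int (u j) div q) * \<mu> j k)"
        by (rule sum.swap)
      also have "\<dots> = 0" using mu0(1) by (simp add: sum_distrib_left[symmetric])
      finally show ?thesis using that by (simp add: red_def sum_subtractf of_nat_sum[symmetric])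
    qed
    have I: "red u k = red u' k" if "k \<in> I" for k
      using fun_cong[OF eq, of k] that by (simp add: \<kappa>_def)
    have "(\<Sum>k\<le>N. red u k) = red u k0 + (\<Sum>k\<in>I. red u k)" for u
      unfolding I_def using k0(1) by (intro sum.remove) auto
    \<comment> \<open>The rows \<open>\<mu> j\<close> have zero sum, so reduction preserves the
      total degree and the entry at \<open>k0\<close> follows from the others.\<close>
    then have "red u k0 = red u' k0"
      using sumred[OF u(1)] sumred[OF u'(1)] sum.cong[OF refl I, of I] by simp
    then have red_eq: "red u k = red u' k" for k
      using I mu0(2) u(2) u'(2) by (cases "k \<le> N"; cases "k = k0") (auto simp: I_def red_def)
    have diff: "int (u k) - int (u' k) =
        0 - (\<Sum>j\<in>J. (int (u' j) div q - int (u j) div q) * \<mu> j k)" for k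
      using red_eq[of k] by (simp add: red_def left_diff_distrib sum_subtractf)
    show ?thesis
      unfolding diff by (intro int_span_minus_sum fin int_span_zero sp)
  qed
  show ?thesis
  proof (rule exI[of _ "nat q ^ i"], rule exI[of _ "nat (2 * A)"], rule allI)
    fix D
    show "\<exists>(K :: (nat \<Rightarrow> int) set) \<kappa>. finite K \<and> card K \<le> nat q ^ i * (nat (2 * A) * D + 1) ^ (N - i) \<and>
      (\<forall>u. (\<Sum>k\<le>N. u k) = D \<and> (\<forall>k>N. u k = 0) \<longrightarrow> \<kappa> u \<in> K) \<and>
      (\<forall>u u'. (\<Sum>k\<le>N. u k) = D \<and> (\<forall>k>N. u k = 0) \<and> (\<Sum>k\<le>N. u' k) = D \<and> (\<forall>k>N. u' k = 0) \<and>
        \<kappa> u = \<kappa> u' \<longrightarrow> (\<lambda>k. int (u k) - int (u' k)) \<in> int_span i v)"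
      by (rule exI[of _ "K D"], rule exI[of _ \<kappa>],
          intro conjI allI impI finK cardK inK spanK[where D = D]) auto
  qed
qed

section \<open>The upper bound for the dimension\<close>

text \<open>On \<open>X\<close> a form is governed by its class sums at \<alpha>, so a combination
  vanishes there as soon as its coefficients, more than \<open>card K\<close> in number, satisfy
  \<open>card K\<close> linear conditions.\<close>

lemma forms_dependent:
  fixes \<alpha> :: "nat \<Rightarrow> 'k::field" and g :: "'l \<Rightarrow> 'k mpol"
  assumes L: "finite L" and g: "\<And>l. l \<in> L \<Longrightarrow> g l \<in> forms N D"
    and K: "finite K" "card K < card L"
    and \<kappa>: "\<And>u. Poly_Mapping.keys u \<subseteq> {..N} \<Longrightarrow> (\<Sum>k\<le>N. Poly_Mapping.lookup u k) = D \<Longrightarrow> \<kappa> u \<in> K"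
    and \<alpha>: "\<And>k. k \<le> N \<Longrightarrow> \<alpha> k \<noteq> 0"
    and X: "\<And>x k. x \<in> X \<Longrightarrow> k \<le> N \<Longrightarrow> x k \<noteq> 0"
    and classes: "\<And>x u u'. x \<in> X \<Longrightarrow> Poly_Mapping.keys u \<subseteq> {..N} \<Longrightarrow> Poly_Mapping.keys u' \<subseteq> {..N} \<Longrightarrow>
      (\<Sum>k\<le>N. Poly_Mapping.lookup u k) = D \<Longrightarrow> (\<Sum>k\<le>N. Poly_Mapping.lookup u' k) = D \<Longrightarrow> \<kappa> u = \<kappa> u' \<Longrightarrow>
      chr N (\<lambda>k. x k / \<alpha> k) (\<lambda>k. int (Poly_Mapping.lookup u k) - int (Poly_Mapping.lookup u' k)) = 1"
  shows "\<exists>c. (\<exists>l\<in>L. c l \<noteq> 0) \<and> (\<forall>x\<in>X. (\<Sum>l\<in>L. c l * mpol_eval (g l) x) = 0)"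
proof -
  define M where "M = (\<Union>l\<in>L. Poly_Mapping.keys (g l))"
  have M: "finite M" using L by (simp add: M_def)
  have deg: "Poly_Mapping.keys u \<subseteq> {..N}" "(\<Sum>k\<le>N. Poly_Mapping.lookup u k) = D" if "u \<in> M" for u
    using that formsD[OF g] by (auto simp: M_def)
  define A where "A = (\<lambda>\<psi> l. \<Sum>u\<in>{u \<in> M. \<kappa> u = \<psi>}. Poly_Mapping.lookup (g l) u * monom_eval \<alpha> u)"
  obtain c where c: "\<exists>l\<in>L. c l \<noteq> 0" "\<forall>\<psi>\<in>K. (\<Sum>l\<in>L. A \<psi> l * c l) = 0"
    using underdetermined_system[OF K(1) L K(2), of A] by blast
  define f where "f = (\<Sum>l\<in>L. Poly_Mapping.single 0 (c l) * g l)"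
  have lf: "Poly_Mapping.lookup f u = (\<Sum>l\<in>L. c l * Poly_Mapping.lookup (g l) u)" for u
    by (simp add: f_def lookup_sum lookup_const_mult)
  have "(\<Sum>l\<in>L. c l * mpol_eval (g l) x) = 0" if x: "x \<in> X" for x
  proof -
    have "mpol_eval f x = 0"
    proof (rule form_vanishes_by_classes[of M f N x \<alpha> \<kappa>])
      show "Poly_Mapping.keys f \<subseteq> M"
      proof
        fix u assume "u \<in> Poly_Mapping.keys f"
        then have "(\<Sum>l\<in>L. c l * Poly_Mapping.lookup (g l) u) \<noteq> 0" by (simp add: in_keys_iff lf)
        then obtain l where "l \<in> L" "c l * Poly_Mapping.lookup (g l) u \<noteq> 0"
          by (rule sum.not_neutral_contains_not_neutral)
        then show "u \<in> M" by (auto simp: M_def in_keys_iff)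
      qed
      show "(\<Sum>u\<in>{u \<in> M. \<kappa> u = \<psi>}. Poly_Mapping.lookup f u * monom_eval \<alpha> u) = 0" if "\<psi> \<in> \<kappa> ` M" for \<psi>
      proof -
        have "(\<Sum>u\<in>{u \<in> M. \<kappa> u = \<psi>}. Poly_Mapping.lookup f u * monom_eval \<alpha> u) =
            (\<Sum>u\<in>{u \<in> M. \<kappa> u = \<psi>}. \<Sum>l\<in>L. Poly_Mapping.lookup (g l) u * monom_eval \<alpha> u * c l)"
          unfolding lf sum_distrib_right by (intro sum.cong refl) (simp add: mult_ac)
        also have "\<dots> = (\<Sum>l\<in>L. A \<psi> l * c l)"
          unfolding A_def sum_distrib_right by (rule sum.swap)
        also have "\<dots> = 0" using c(2) \<kappa> deg that by auto
        finally show ?thesis .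
      qed
      show "chr N (\<lambda>k. x k / \<alpha> k)
          (\<lambda>k. int (Poly_Mapping.lookup u k) - int (Poly_Mapping.lookup u' k)) = 1"
        if "u \<in> M" "u' \<in> M" "\<kappa> u = \<kappa> u'" for u u'
        using classes[OF x] deg that by blast
    qed (use M deg X[OF x] \<alpha> in auto)
    then show ?thesis
      by (simp add: f_def mpol_eval_sum mpol_eval_mult mpol_eval_single monom_eval_def)
  qed
  then show ?thesis using c(1) by blast
qed

lemma chain_length_bound:
  fixes \<alpha> :: "nat \<Rightarrow> 'k::field" and Z :: "nat \<Rightarrow> 'k ppoint set"
  assumes S: "S \<subseteq> proj_torus N"
    and \<alpha>: "\<And>k. k \<le> N \<Longrightarrow> \<alpha> k \<noteq> 0"
    and li: "lin_indep_family i v" and supp: "\<And>l k. l < i \<Longrightarrow> k > N \<Longrightarrow> v l k = 0"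
    and sum0: "\<And>l. l < i \<Longrightarrow> (\<Sum>k\<le>N. v l k) = 0" and iN: "i \<le> N"
    and rel: "\<And>x l. x \<in> torus_vec N \<Longrightarrow> pt x \<in> S \<Longrightarrow> l < i \<Longrightarrow> chr N (\<lambda>k. x k / \<alpha> k) (v l) = 1"
    and Z: "\<And>j. j \<le> m \<Longrightarrow> closedin (subtopology (zariski N) S) (Z j)"
      "\<And>j. j \<le> m \<Longrightarrow> irreducible_space (subtopology (subtopology (zariski N) S) (Z j))"
      "\<And>j. j < m \<Longrightarrow> Z j \<subset> Z (Suc j)"
  shows "m \<le> N - i"
proof (rule ccontr)
  assume mp: "\<not> m \<le> N - i"
  have S': "S \<subseteq> proj_space N" using S proj_torus_subset by blast
  have ZS: "Z j \<subseteq> S" if "j \<le> m" for j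
    using closedin_subset[OF Z(1)[OF that]] topspace_subtopology_zariski[OF S'] by simp
  then have ZT: "Z j \<subseteq> proj_torus N" if "j \<le> m" for j using that S by blast
  have irr: "irreducible_space (subtopology (zariski N) (Z j))" if "j \<le> m" for j
    using Z(2)[OF that] ZS[OF that] by (simp add: subtopology_subtopology inf.absorb2)
  have "\<exists>D f. f \<in> forms N D \<and> vanishes f (Z j) \<and> \<not> vanishes f (Z (Suc j))" if "j < m" for j
    using closed_separating_form[OF Z(1) Z(3) ZS S', of j] that by auto
  then obtain dg f where f: "\<And>j. j < m \<Longrightarrow> f j \<in> forms N (dg j)"
      "\<And>j. j < m \<Longrightarrow> vanishes (f j) (Z j)" "\<And>j. j < m \<Longrightarrow> \<not> vanishes (f j) (Z (Suc j))"
    by metis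
  define d where "d = (\<Sum>j<m. dg j)"
  define \<phi> where "\<phi> = (\<lambda>j. mpol_eval (f j))"
  have pf: "polyfun N d (\<phi> j)" if "j < m" for j
    unfolding \<phi>_def using that member_le_sum[of j "{..<m}" dg]
    by (intro polyfun_mono[OF polyfun_form[OF f(1)]]) (auto simp: d_def)
  obtain Q C :: nat where QC: "\<And>D. \<exists>(K :: (nat \<Rightarrow> int) set) \<kappa>.
    finite K \<and> card K \<le> Q * (C * D + 1) ^ (N - i) \<and>
    (\<forall>u. (\<Sum>k\<le>N. u k) = D \<and> (\<forall>k>N. u k = 0) \<longrightarrow> \<kappa> u \<in> K) \<and>
    (\<forall>u u'. (\<Sum>k\<le>N. u k) = D \<and> (\<forall>k>N. u k = 0) \<and> (\<Sum>k\<le>N. u' k) = D \<and> (\<forall>k>N. u' k = 0) \<and>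
      \<kappa> u = \<kappa> u' \<longrightarrow> (\<lambda>k. int (u k) - int (u' k)) \<in> int_span i v)"
    using lattice_classes[OF li supp sum0 iN] by blast
  define p where "p = N - i"
  \<comment> \<open>Chosen to absorb the constants: with \<open>D = d * B * m\<close> the number of
    classes is at most \<open>B * Suc B ^ p\<close>, which is less than the number
    \<open>Suc B ^ m\<close> of power products once \<open>m\<close> exceeds \<open>p\<close>. All
    these products come from forms of the same degree \<open>D\<close>.\<close>
  define B where "B = Q * (C * d * m + 1) ^ p"
  define D where "D = d * B * m"
  let ?L = "exponent_lists B m"
  obtain K :: "(nat \<Rightarrow> int) set" and \<kappa> where K: "finite K" "card K \<le> Q * (C * D + 1) ^ (N - i)"
    and \<kappa>1: "\<forall>u. (\<Sum>k\<le>N. u k) = D \<and> (\<forall>k>N. u k = 0) \<longrightarrow> \<kappa> u \<in> K"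
    and \<kappa>2: "\<forall>u u'. (\<Sum>k\<le>N. u k) = D \<and> (\<forall>k>N. u k = 0) \<and> (\<Sum>k\<le>N. u' k) = D \<and>
      (\<forall>k>N. u' k = 0) \<and> \<kappa> u = \<kappa> u' \<longrightarrow> (\<lambda>k. int (u k) - int (u' k)) \<in> int_span i v"
    using QC[of D] by (elim exE conjE) (rule that)
  have "Q * (C * D + 1) ^ p \<le> Q * ((C * d * m + 1) * Suc B) ^ p"
    by (intro mult_left_mono power_mono) (auto simp: D_def)
  also have "\<dots> = B * Suc B ^ p" by (simp only: power_mult_distrib B_def mult.assoc)
  also have "\<dots> < Suc B ^ Suc p" by simp
  also have "\<dots> \<le> Suc B ^ m" using mp by (intro power_increasing) (auto simp: p_def)
  finally have card: "card K < card ?L" using K(2)[folded p_def] by (simp add: card_exponent_lists)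
  have "\<exists>g. g \<in> forms N D \<and> (\<forall>x. x 0 = 1 \<longrightarrow> mpol_eval g x = power_product \<phi> bs x)" if "bs \<in> ?L" for bs
    using polyfun_power_product[of bs N d \<phi> B] pf that
    unfolding polyfun_def exponent_lists_def D_def by auto
  then obtain g where g: "\<And>bs. bs \<in> ?L \<Longrightarrow> g bs \<in> forms N D"
      "\<And>bs x. bs \<in> ?L \<Longrightarrow> x 0 = 1 \<Longrightarrow> mpol_eval (g bs) x = power_product \<phi> bs x"
    by metis
  have lookup0: "\<forall>k>N. Poly_Mapping.lookup u k = 0" if "Poly_Mapping.keys u \<subseteq> {..N}"
    for u :: "nat \<Rightarrow>\<^sub>0 nat"
    using that by (metis atMost_iff in_keys_iff not_le subsetD)
  have "\<exists>c. (\<exists>bs\<in>?L. c bs \<noteq> 0) \<and> (\<forall>x\<in>chart N S. (\<Sum>bs\<in>?L. c bs * mpol_eval (g bs) x) = 0)"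
  proof (rule forms_dependent[OF finite_exponent_lists g(1) K(1) card,
        where \<kappa> = "\<lambda>u. \<kappa> (Poly_Mapping.lookup u)" and \<alpha> = \<alpha>])
    fix x u u'
    assume x: "x \<in> chart N S" and u: "Poly_Mapping.keys u \<subseteq> {..N}" "Poly_Mapping.keys u' \<subseteq> {..N}"
      "(\<Sum>k\<le>N. Poly_Mapping.lookup u k) = D" "(\<Sum>k\<le>N. Poly_Mapping.lookup u' k) = D"
      "\<kappa> (Poly_Mapping.lookup u) = \<kappa> (Poly_Mapping.lookup u')"
    have "(\<lambda>k. int (Poly_Mapping.lookup u k) - int (Poly_Mapping.lookup u' k)) \<in> int_span i v"
      using \<kappa>2[rule_format, of "Poly_Mapping.lookup u" "Poly_Mapping.lookup u'"] u lookup0 by blast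
    then show "chr N (\<lambda>k. x k / \<alpha> k)
        (\<lambda>k. int (Poly_Mapping.lookup u k) - int (Poly_Mapping.lookup u' k)) = 1"
    proof (rule chr_int_span[rotated 2])
      show "x k / \<alpha> k \<noteq> 0" if "k \<le> N" for k
        using x \<alpha> that by (simp add: chart_def torus_vec_def)
      show "chr N (\<lambda>k. x k / \<alpha> k) (v l) = 1" if "l < i" for l
        using x that by (intro rel) (auto simp: chart_def)
    qed
  next
    show "\<kappa> (Poly_Mapping.lookup u) \<in> K"
      if "Poly_Mapping.keys u \<subseteq> {..N}" "(\<Sum>k\<le>N. Poly_Mapping.lookup u k) = D" for u
      using \<kappa>1[rule_format, of "Poly_Mapping.lookup u"] lookup0 that by blast
    show "x k \<noteq> 0" if "x \<in> chart N S" "k \<le> N" for x k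
      using that by (simp add: chart_def torus_vec_def)
  qed (assumption, rule \<alpha>)
  then obtain c where c: "\<exists>bs\<in>?L. c bs \<noteq> 0"
      "\<And>x. x \<in> chart N S \<Longrightarrow> (\<Sum>bs\<in>?L. c bs * mpol_eval (g bs) x) = 0"
    by blast
  have "\<forall>bs\<in>?L. c bs = 0"
  proof (rule chain_independent[of m Z N \<phi>])
    show "(\<Sum>bs\<in>?L. c bs * power_product \<phi> bs x) = 0" if x: "x \<in> chart N (Z m)" for x
    proof -
      have "x \<in> chart N S" "x 0 = 1" using x ZS[of m] by (auto simp: chart_def)
      then show ?thesis using c(2)[of x] g(2) by simp
    qed
    show "\<phi> j x = 0" if "j < m" "x \<in> chart N (Z j)" for j x
      using f(2)[OF that(1)] vanishes_chart[OF f(1) ZT] that by (simp add: \<phi>_def)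
    show "\<exists>x\<in>chart N (Z (Suc j)). \<phi> j x \<noteq> 0" if "j < m" for j
      using f(3)[OF that] vanishes_chart[OF f(1)[OF that] ZT[of "Suc j"]] that by (auto simp: \<phi>_def)
    show "Z j \<subseteq> Z (Suc j)" if "j < m" for j using Z(3)[OF that] by blast
    show "regular N (\<phi> j)" if "j < m" for j using pf[OF that] by (auto simp: regular_def)
  qed (use ZT irr in auto)
  then show False using c(1) by blast
qed

section \<open>The lower bound for the dimension\<close>

lemma mpol_eval_poly:
  "mpol_eval f (\<lambda>i. poly (p i) c) =
    poly (\<Sum>m\<in>Poly_Mapping.keys f. [:Poly_Mapping.lookup f m:] *
      (\<Prod>j\<in>Poly_Mapping.keys m. p j ^ Poly_Mapping.lookup m j)) c"
  by (simp add: mpol_eval_def monom_eval_def poly_sum poly_prod)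

text \<open>Exponents are natural numbers so that univariate polynomials can be substituted for the
  parameters. Only parameters in \<open>T\<close> vary; the others count as one.\<close>

definition monomial_vec ::
    "nat \<Rightarrow> (nat \<Rightarrow> 'k::field) \<Rightarrow> (nat \<Rightarrow> nat \<Rightarrow> nat) \<Rightarrow> nat set \<Rightarrow> (nat \<Rightarrow> 'k) \<Rightarrow> nat \<Rightarrow> 'k" where
  "monomial_vec N \<alpha> w T t = (\<lambda>i. if i \<le> N then \<alpha> i * (\<Prod>k\<in>T. t k ^ w k i) else 0)"

text \<open>Two points of the image are joined by the image of a line, on which both forms restrict to
  nonzero univariate polynomials.\<close>

lemma monomial_image_prime:
  fixes \<alpha> :: "nat \<Rightarrow> 'k::field"
  assumes inf: "infinite (UNIV :: 'k set)" and T: "finite T"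
    and fg: "\<And>t. \<forall>k\<in>T. t k \<noteq> 0 \<Longrightarrow>
      mpol_eval f (monomial_vec N \<alpha> w T t) * mpol_eval g (monomial_vec N \<alpha> w T t) = 0"
    and t: "\<forall>k\<in>T. t k \<noteq> 0" "mpol_eval f (monomial_vec N \<alpha> w T t) \<noteq> 0"
    and u: "\<forall>k\<in>T. u k \<noteq> 0"
  shows "mpol_eval g (monomial_vec N \<alpha> w T u) = 0"
proof (rule ccontr)
  assume g: "mpol_eval g (monomial_vec N \<alpha> w T u) \<noteq> 0"
  define L where "L = (\<lambda>k. [:t k, u k - t k:])"
  define p where "p = (\<lambda>i. if i \<le> N then [:\<alpha> i:] * (\<Prod>k\<in>T. L k ^ w k i) else 0)"
  have p: "(\<lambda>i. poly (p i) c) = monomial_vec N \<alpha> w T (\<lambda>k. poly (L k) c)" for c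
    by (auto simp: p_def monomial_vec_def poly_prod fun_eq_iff)
  define F where "F = (\<lambda>f. \<Sum>m\<in>Poly_Mapping.keys f. [:Poly_Mapping.lookup f m:] *
      (\<Prod>j\<in>Poly_Mapping.keys m. p j ^ Poly_Mapping.lookup m j))"
  have F: "poly (F f) c = mpol_eval f (monomial_vec N \<alpha> w T (\<lambda>k. poly (L k) c))" for f c
    using mpol_eval_poly[of f p c] by (simp add: p F_def)
  \<comment> \<open>The line passes through \<open>t\<close> at 0 and \<open>u\<close> at 1.
    Nonvanishing of \<open>R\<close> at \<open>c\<close> keeps its point in the domain of the
    parametrisation.\<close>
  define R where "R = (\<Prod>k\<in>T. L k)"
  have L01: "(\<lambda>k. poly (L k) 0) = t" "(\<lambda>k. poly (L k) 1) = u" by (auto simp: L_def)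
  have "poly (F f) 0 \<noteq> 0" "poly (F g) 1 \<noteq> 0" using t(2) g by (simp_all only: F L01 not_False_eq_True)
  moreover have "poly R 0 \<noteq> 0" using t(1) T by (simp add: R_def L_def poly_prod)
  ultimately have "F f * F g * R \<noteq> 0" by auto
  then obtain c where c: "poly (F f * F g * R) c \<noteq> 0"
    using poly_roots_finite[of "F f * F g * R"] inf
      ex_new_if_finite[of "{c. poly (F f * F g * R) c = 0}"]
    by blast
  then have "\<forall>k\<in>T. poly (L k) c \<noteq> 0" using T by (auto simp: R_def poly_prod)
  then have "mpol_eval f (monomial_vec N \<alpha> w T (\<lambda>k. poly (L k) c)) *
      mpol_eval g (monomial_vec N \<alpha> w T (\<lambda>k. poly (L k) c)) = 0"
    by (rule fg)
  then show False using c by (simp add: F)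
qed

text \<open>The exponent vectors \<open>q e\<^sub>k - (\<Sum>j\<in>J. \<mu> j k \<cdot> e\<^sub>j)\<close>, for \<open>k \<notin> J\<close>, are orthogonal to \<open>G\<close>; so
  are their translates by multiples of the all-one vector, which can be made nonnegative.  Letting
  more and more of the corresponding parameters vary gives the chain.\<close>

lemma chain_exists:
  fixes \<alpha> :: "nat \<Rightarrow> 'k::field"
  assumes inf: "infinite (UNIV :: 'k set)" and \<alpha>: "\<And>k. k \<le> N \<Longrightarrow> \<alpha> k \<noteq> 0"
    and e: "echelon N r v J q \<mu>" and rN: "r \<le> N"
    and rel: "\<And>l k. l \<in> G \<Longrightarrow> q * l k = (\<Sum>j\<in>J. l j * \<mu> j k)"
    and sum0: "\<And>l. l \<in> G \<Longrightarrow> (\<Sum>k\<le>N. l k) = 0"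
    and S: "S \<subseteq> proj_torus N"
    and inS: "\<And>x. x \<in> torus_vec N \<Longrightarrow> (\<forall>l\<in>G. chr N (\<lambda>k. x k / \<alpha> k) l = 1) \<Longrightarrow> pt x \<in> S"
  shows "\<exists>Z. (\<forall>j\<le>N - r. closedin (subtopology (zariski N) S) (Z j) \<and>
      irreducible_space (subtopology (subtopology (zariski N) S) (Z j))) \<and>
    (\<forall>j<N - r. Z j \<subset> Z (Suc j))"
proof -
  have J: "J \<subseteq> {..N}" "card J = r" and q: "q > 0" using e by (auto simp: echelon_def)
  have fin: "finite J" using J(1) finite_subset by blast
  have "{..N} - J \<noteq> {}" using J rN card_mono[of J "{..N}"] fin by fastforce
  \<comment> \<open>A coordinate with neither pivot nor parameter, the reference for comparing the
    others; giving it up accounts for the common scaling of homogeneous coordinates.\<close>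
  then obtain k0 where k0: "k0 \<le> N" "k0 \<notin> J" by blast
  define C where "C = {..N} - insert k0 J"
  have cardC: "card C = N - r" using J k0 fin by (simp add: C_def card_Diff_subset)
  have "finite C" by (simp add: C_def)
  from ex_bij_betw_nat_finite[OF this] obtain h where h: "bij_betw h {0..<N - r} C"
    unfolding cardC by blast
  have hC: "h j \<in> C" if "j < N - r" for j using h that by (auto simp: bij_betw_def)
  have hinj: "j = j'" if "h j = h j'" "j < N - r" "j' < N - r" for j j'
    using h that by (auto simp: bij_betw_def inj_on_def)
  define M where "M = (\<Sum>j\<in>J. \<Sum>k\<le>N. \<bar>\<mu> j k\<bar>)"
  define W where "W = (\<lambda>k i. (if i = k then q else 0) - (if i \<in> J then \<mu> i k else 0) + M)"
  define w where "w = (\<lambda>k i. nat (W k i))"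
  have M0: "M \<ge> 0" by (simp add: M_def sum_nonneg)
  have W0: "W k i \<ge> 0" if "k \<in> C" for k i
  proof (cases "i \<in> J")
    case True
    have "\<mu> i k \<le> \<bar>\<mu> i k\<bar>" by simp
    also have "\<dots> \<le> (\<Sum>k\<le>N. \<bar>\<mu> i k\<bar>)" using that by (intro member_le_sum) (auto simp: C_def)
    also have "\<dots> \<le> M" unfolding M_def using True fin
      by (intro member_le_sum[of i J "\<lambda>j. \<Sum>k\<le>N. \<bar>\<mu> j k\<bar>"]) (auto simp: sum_nonneg)
    finally show ?thesis using True q M0 by (auto simp: W_def)
  qed (use q M0 in \<open>simp add: W_def\<close>)
  have orth: "(\<Sum>i\<le>N. l i * W k i) = 0" if l: "l \<in> G" and k: "k \<in> C" for l k
  proof -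
    have "(\<Sum>i\<le>N. l i * W k i) = (\<Sum>i\<le>N. if k = i then l i * q else 0)
        - (\<Sum>i\<le>N. if i \<in> J then l i * \<mu> i k else 0) + (\<Sum>i\<le>N. l i) * M"
      unfolding sum_distrib_right sum_subtractf[symmetric] sum.distrib[symmetric]
      by (intro sum.cong refl) (simp add: W_def algebra_simps)
    also have "(\<Sum>i\<le>N. if k = i then l i * q else 0) = l k * q"
      using k by (simp add: C_def)
    also have "(\<Sum>i\<le>N. if i \<in> J then l i * \<mu> i k else 0) = (\<Sum>i\<in>J. l i * \<mu> i k)"
      using J(1) by (simp add: sum.inter_restrict[symmetric] Int_absorb1)
    finally show ?thesis using rel[OF l, of k] sum0[OF l] by (simp add: mult.commute)
  qed
  define V where "V = (\<lambda>T. monomial_vec N \<alpha> w T)"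
  have V: "V T t \<in> torus_vec N" "pt (V T t) \<in> S"
    if T: "T \<subseteq> C" and t: "\<forall>k\<in>T. t k \<noteq> 0" for T t
  proof -
    have fT: "finite T" using T \<open>finite C\<close> finite_subset by blast
    show tv: "V T t \<in> torus_vec N"
      using \<alpha> t fT by (auto simp: V_def monomial_vec_def torus_vec_def)
    have "chr N (\<lambda>k. V T t k / \<alpha> k) l = 1" if l: "l \<in> G" for l
    proof -
      have "chr N (\<lambda>k. V T t k / \<alpha> k) l = chr N (\<lambda>i. \<Prod>k\<in>T. t k powi W k i) l"
        unfolding chr_def
      proof (intro prod.cong refl)
        fix i assume "i \<in> {..N}"
        then have "V T t i / \<alpha> i = (\<Prod>k\<in>T. t k powi W k i)"
          using \<alpha>[of i] W0 T
            by (auto simp: V_def monomial_vec_def w_def power_int_def intro!: prod.cong)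
        then show "(V T t i / \<alpha> i) powi l i = (\<Prod>k\<in>T. t k powi W k i) powi l i" by simp
      qed
      also have "\<dots> = (\<Prod>k\<in>T. t k powi (\<Sum>i\<le>N. l i * W k i))"
        using t chr_monomial_point[of T t N "\<lambda>i k. W k i" l] by simp
      also have "\<dots> = 1" using orth[OF l] T by (intro prod.neutral) auto
      finally show ?thesis .
    qed
    then show "pt (V T t) \<in> S" using inS[OF tv] by blast
  qed
  define T where "T = (\<lambda>j. h ` {..<j})"
  have TC: "T j \<subseteq> C" if "j \<le> N - r" for j using that hC by (auto simp: T_def)
  define Im where "Im = (\<lambda>j. {pt (V (T j) t) | t. \<forall>k\<in>T j. t k \<noteq> 0})"
  \<comment> \<open>The Zariski closure of \<open>Im j\<close> within \<open>S\<close>, expressed by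
    forms, so that irreducibility is inherited from the image.\<close>
  define Z where "Z = (\<lambda>j. {P \<in> S. \<forall>D. \<forall>f\<in>forms N D. vanishes f (Im j) \<longrightarrow> vanishes f {P}})"
  have ImS: "Im j \<subseteq> S" if "j \<le> N - r" for j using V(2)[OF TC[OF that]] by (auto simp: Im_def)
  have ImZ: "Im j \<subseteq> Z j" if "j \<le> N - r" for j
    using ImS[OF that] by (auto simp: Z_def vanishes_def)
  have S': "S \<subseteq> proj_space N" using S proj_torus_subset by blast
  have vanIm: "vanishes f (Im j) \<longleftrightarrow> (\<forall>t. (\<forall>k\<in>T j. t k \<noteq> 0) \<longrightarrow> mpol_eval f (V (T j) t) = 0)"
    if "f \<in> forms N D" for f D j
    unfolding vanishes_def Im_def using form_zero_on_pt[OF that] by blast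
  have closed: "closedin (subtopology (zariski N) S) (Z j)" for j
  proof -
    let ?F = "\<Union>D. {f \<in> forms N D. vanishes f (Im j)}"
    have "Z j = proj_zeros N ?F \<inter> S"
      using S' unfolding Z_def proj_zeros_def vanishes_def by fast
    moreover have "?F \<subseteq> (\<Union>D. forms N D)" by blast
    ultimately show ?thesis unfolding closedin_subtopology closedin_zariski by blast
  qed
  have irr: "irreducible_space (subtopology (subtopology (zariski N) S) (Z j))" if j: "j \<le> N - r" for j
  proof -
    have "irreducible_space (subtopology (zariski N) (Z j))"
    proof (rule irreducible_spaceI)
      show "Z j \<subseteq> proj_space N" using S' by (auto simp: Z_def)
      have "pt (V (T j) (\<lambda>_. 1)) \<in> Im j" unfolding Im_def by (intro CollectI exI[of _ "\<lambda>_. 1"]) auto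
      then show "Z j \<noteq> {}" using ImZ[OF j] by blast
      fix f g D E
      assume f: "f \<in> forms N D" and g: "g \<in> forms N E"
        and fg: "\<forall>P\<in>Z j. \<forall>x\<in>P. mpol_eval f x * mpol_eval g x = 0"
      have "mpol_eval f (V (T j) t) * mpol_eval g (V (T j) t) = 0" if "\<forall>k\<in>T j. t k \<noteq> 0" for t
      proof -
        have "pt (V (T j) t) \<in> Z j" using that ImZ[OF j] by (auto simp: Im_def)
        then show ?thesis using fg self_in_pt by blast
      qed
      then have "vanishes f (Im j) \<or> vanishes g (Im j)"
        unfolding vanIm[OF f] vanIm[OF g] V_def
        using monomial_image_prime[OF inf, of "T j" f N \<alpha> w g] by (auto simp: T_def)
      then show "vanishes f (Z j) \<or> vanishes g (Z j)"
        using f g by (auto simp: Z_def vanishes_def)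
    qed
    moreover have "S \<inter> Z j = Z j" by (auto simp: Z_def)
    ultimately show ?thesis by (simp add: subtopology_subtopology)
  qed
  have "Z j \<subset> Z (Suc j)" if j: "j < N - r" for j
  proof
    have hT: "h j \<notin> T j"
    proof
      assume "h j \<in> T j"
      then obtain j' where "j' < j" "h j = h j'" by (auto simp: T_def)
      then show False using hinj[of j j'] j by simp
    qed
    have "vanishes f (Im j)" if f: "f \<in> forms N D" and v: "vanishes f (Im (Suc j))" for f D
      unfolding vanIm[OF f]
    proof (intro allI impI)
      fix t :: "nat \<Rightarrow> 'k" assume t: "\<forall>k\<in>T j. t k \<noteq> 0"
      \<comment> \<open>Setting the new parameter to one shows that \<open>Im j\<close> is part of
        \<open>Im (Suc j)\<close>.\<close>
      let ?t = "t(h j := 1)"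
      have TS: "T (Suc j) = insert (h j) (T j)" by (auto simp: T_def lessThan_Suc)
      have "(\<Prod>k\<in>T j. ?t k ^ w k i) = (\<Prod>k\<in>T j. t k ^ w k i)" for i
        using hT by (intro prod.cong) auto
      moreover have "finite (T j)" by (simp add: T_def)
      ultimately have "V (T (Suc j)) ?t = V (T j) t"
        using hT by (auto simp: V_def monomial_vec_def TS fun_eq_iff)
      moreover have "\<forall>k\<in>T (Suc j). ?t k \<noteq> 0" using t by (auto simp: TS)
      ultimately show "mpol_eval f (V (T j) t) = 0" using v unfolding vanIm[OF f] by metis
    qed
    then show "Z j \<subseteq> Z (Suc j)" by (auto simp: Z_def)
    \<comment> \<open>While only parameters in \<open>T j\<close> vary, the coordinates
      \<open>h j\<close> and \<open>k0\<close> carry the same exponents, so this linear form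
      vanishes. The parameter at \<open>h j\<close> enters coordinate \<open>h j\<close> with an
      exponent larger by \<open>q\<close> than at \<open>k0\<close>, so a value \<open>c\<close>
      with \<open>c powi q\<close> different from one gives a point where the form is
      nonzero.\<close>
    define f where "f = Poly_Mapping.single (Poly_Mapping.single (h j) (1::nat)) (\<alpha> k0) +
        Poly_Mapping.single (Poly_Mapping.single k0 (1::nat)) (- \<alpha> (h j))"
    have hj: "h j \<le> N" "h j \<notin> J" "h j \<noteq> k0" using hC[OF j] by (auto simp: C_def)
    have f: "f \<in> forms N 1"
      unfolding f_def using hj(1) k0(1)
      by (intro forms_add single_in_forms) (auto simp: lookup_single when_def sum.delta)
    have ev: "mpol_eval f x = \<alpha> k0 * x (h j) - \<alpha> (h j) * x k0" for x
      by (simp add: f_def mpol_eval_add mpol_eval_single monom_eval_def)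
    have "mpol_eval f (V (T j) t) = 0" for t
    proof -
      have "w k (h j) = w k k0" if "k \<in> T j" for k
      proof -
        have "k \<noteq> h j" using that hT by blast
        moreover have "k \<noteq> k0" using TC[of j] that j by (auto simp: C_def)
        ultimately show ?thesis using hj k0 by (simp add: w_def W_def)
      qed
      then have "(\<Prod>k\<in>T j. t k ^ w k (h j)) = (\<Prod>k\<in>T j. t k ^ w k k0)"
        by (intro prod.cong) auto
      then show ?thesis using hj(1) k0(1) by (simp add: ev V_def monomial_vec_def)
    qed
    then have van: "vanishes f (Im j)" unfolding vanIm[OF f] by blast
    obtain c :: 'k where c: "c \<noteq> 0" "c powi q \<noteq> 1"
      using exists_power_neq_1[OF inf, of q] q by auto
    define t where "t = (\<lambda>k. if k = h j then c else 1)"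
    define P where "P = pt (V (T (Suc j)) t)"
    have hTS: "h j \<in> T (Suc j)" by (auto simp: T_def)
    have pr: "(\<Prod>k\<in>T (Suc j). t k ^ w k i) = c ^ w (h j) i" for i
    proof -
      have "(\<Prod>k\<in>T (Suc j). t k ^ w k i) = (\<Prod>k\<in>T (Suc j). if h j = k then c ^ w k i else 1)"
        by (intro prod.cong) (auto simp: t_def)
      also have "\<dots> = c ^ w (h j) i" using hTS by (simp add: T_def)
      finally show ?thesis .
    qed
    have "w (h j) (h j) = nat q + w (h j) k0"
      using hj k0 q M0 by (simp add: w_def W_def nat_add_distrib)
    moreover have "c ^ nat q \<noteq> 1" using c(2) q by (simp add: power_int_def)
    ultimately have "mpol_eval f (V (T (Suc j)) t) \<noteq> 0"
      using hj(1) k0(1) c(1) \<alpha> by (simp add: ev V_def monomial_vec_def pr power_add)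
    then have "\<not> vanishes f {P}"
      using self_in_pt[of "V (T (Suc j)) t"] by (auto simp: vanishes_def P_def)
    then have "P \<notin> Z j" using van f by (auto simp: Z_def)
    moreover have "\<forall>k\<in>T (Suc j). t k \<noteq> 0" using c(1) by (simp add: t_def)
    then have "P \<in> Im (Suc j)" unfolding Im_def P_def by blast
    then have "P \<in> Z (Suc j)" using ImZ[of "Suc j"] j by auto
    ultimately show "Z j \<noteq> Z (Suc j)" by blast
  qed
  then show ?thesis using closed irr by blast
qed

section \<open>The dimension of the common zeros of the forms of given degree\<close>

lemma krull_dim_toric_locus:
  fixes \<alpha> :: "nat \<Rightarrow> 'k::alg_closed_field"
  assumes \<alpha>: "\<forall>k\<le>N. \<alpha> k \<noteq> 0" and iN: "i \<le> N"
  shows "krull_dim (subtopology (zariski N)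
      (proj_zeros N (vanishing_ideal N (toric_variety N n a \<alpha>) \<inter> forms N D) \<inter> proj_torus N))
      \<le> ereal (real N - real i) \<longleftrightarrow>
    (\<exists>v. lin_indep_family i v \<and> (\<forall>j<i. v j \<in> toric_module N n a \<and> l1_norm N (v j) \<le> 2 * real D))"
    (is "krull_dim (subtopology _ ?S) \<le> _ \<longleftrightarrow> _")
proof
  let ?T = "subtopology (zariski N) ?S"
  assume le: "krull_dim ?T \<le> ereal (real N - real i)"
  define G where "G = {l \<in> toric_module N n a. l1_norm N l \<le> 2 * real D}"
  obtain r v J q \<mu> where v: "lin_indep_family r v" "\<forall>l<r. v l \<in> G" and e: "echelon N r v J q \<mu>"
    and mx: "\<forall>x\<in>G. \<forall>k. q * x k = (\<Sum>j\<in>J. x j * \<mu> j k)"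
    using maximal_echelon[of G N] by (auto simp: G_def toric_module_def)
  \<comment> \<open>Short vectors of rank \<open>r < i\<close> would allow a chain of length
    \<open>N - r\<close>, more than the assumed dimension.\<close>
  have "i \<le> r"
  proof (rule ccontr)
    assume "\<not> i \<le> r"
    then have r: "r < i" by simp
    have inS: "pt x \<in> ?S" if "x \<in> torus_vec N" "\<forall>l\<in>G. chr N (\<lambda>k. x k / \<alpha> k) l = 1" for x
      using that(2) unfolding pt_in_toric_locus_iff[OF \<alpha> that(1)] G_def by blast
    have "\<exists>Z. (\<forall>j\<le>N - r. closedin ?T (Z j) \<and> irreducible_space (subtopology ?T (Z j))) \<and>
        (\<forall>j<N - r. Z j \<subset> Z (Suc j))"
    proof (rule chain_exists[OF infinite_UNIV_alg_closed _ e])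
      show "r \<le> N" using r iN by simp
      show "q * l k = (\<Sum>j\<in>J. l j * \<mu> j k)" if "l \<in> G" for l k using mx that by blast
      show "(\<Sum>k\<le>N. l k) = 0" if "l \<in> G" for l using that by (simp add: G_def toric_module_def)
      show "\<alpha> k \<noteq> 0" if "k \<le> N" for k using \<alpha> that by blast
    qed (use inS in auto)
    then have "ereal (real (N - r)) \<le> krull_dim ?T"
      unfolding krull_dim_def by (intro Sup_upper CollectI exI[of _ "N - r"] conjI refl)
    then have "real (N - r) \<le> real N - real i" using le order_trans by fastforce
    then show False using r iN by linarith
  qed
  then have "lin_indep_family i v" using v(1) lin_indep_family_mono by blast
  moreover have "\<forall>j<i. v j \<in> toric_module N n a \<and> l1_norm N (v j) \<le> 2 * real D"
    using v(2) \<open>i \<le> r\<close> by (auto simp: G_def)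
  ultimately show "\<exists>v. lin_indep_family i v \<and>
      (\<forall>j<i. v j \<in> toric_module N n a \<and> l1_norm N (v j) \<le> 2 * real D)" by blast
next
  assume "\<exists>v. lin_indep_family i v \<and> (\<forall>j<i. v j \<in> toric_module N n a \<and> l1_norm N (v j) \<le> 2 * real D)"
  then obtain v where v: "lin_indep_family i v"
      "\<And>j. j < i \<Longrightarrow> v j \<in> toric_module N n a" "\<And>j. j < i \<Longrightarrow> l1_norm N (v j) \<le> 2 * real D"
    by blast
  let ?T = "subtopology (zariski N) ?S"
  have bound: "m \<le> N - i" if Z: "\<forall>j\<le>m. closedin ?T (Z j) \<and> irreducible_space (subtopology ?T (Z j))"
    "\<forall>j<m. Z j \<subset> Z (Suc j)" for m Z
  proof (rule chain_length_bound[of ?S N \<alpha> i v m Z])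
    show "chr N (\<lambda>k. x k / \<alpha> k) (v l) = 1" if x: "x \<in> torus_vec N" "pt x \<in> ?S" and l: "l < i" for x l
      using x(2) v(2,3)[OF l] unfolding pt_in_toric_locus_iff[OF \<alpha> x(1)] by blast
    show "v l k = 0" if "l < i" "k > N" for l k
      using v(2)[OF that(1)] that(2) by (simp add: toric_module_def)
    show "(\<Sum>k\<le>N. v l k) = 0" if "l < i" for l using v(2)[OF that] by (simp add: toric_module_def)
  qed (use \<alpha> v(1) iN Z in blast)+
  have "ereal (real m) \<le> ereal (real N - real i)"
    if "\<forall>j\<le>m. closedin ?T (Z j) \<and> irreducible_space (subtopology ?T (Z j))" "\<forall>j<m. Z j \<subset> Z (Suc j)"
    for m Z
    using bound[OF that] iN by simp
  then show "krull_dim ?T \<le> ereal (real N - real i)"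
    unfolding krull_dim_def by (intro Sup_least) blast
qed

section \<open>Comparison of the two minima\<close>

theorem mainTheorem5:
  fixes N n i :: nat
    and a :: "nat \<Rightarrow> nat \<Rightarrow> int"
    and \<alpha> :: "nat \<Rightarrow> 'k::alg_closed_field"
    and X :: "'k ppoint set"
  assumes "toric_presentation N n a \<alpha> X"
    and "1 \<le> i" and "i \<le> N - n"
  shows "real (omega N X (proj_torus N) i) =
    1/2 * successive_min (toric_module N n a) (l1_norm N) i"
proof -
  let ?\<Gamma> = "toric_module N n a"
  define R where "R = (\<lambda>\<nu>. \<exists>v. lin_indep_family i v \<and> (\<forall>j<i. v j \<in> ?\<Gamma> \<and> l1_norm N (v j) \<le> \<nu>))"
  have \<alpha>: "\<forall>k\<le>N. \<alpha> k \<noteq> 0" and X: "X = toric_variety N n a \<alpha>"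
    using assms(1) by (auto simp: toric_presentation_def)
  have iN: "i \<le> N" using assms(3) by simp
  have omega: "omega N X (proj_torus N) i = (LEAST D. R (2 * real D))"
    unfolding omega_def X R_def krull_dim_toric_locus[OF \<alpha> iN] ..
  have min: "successive_min ?\<Gamma> (l1_norm N) i = (LEAST \<nu>. \<nu> \<ge> 0 \<and> R \<nu>)"
    unfolding successive_min_def R_def ..
  \<comment> \<open>Norms on the module are even integers, so a bound \<nu> may be rounded down to
    an even number. This makes the minimum over real bounds equal to twice the minimum over natural
    degrees.\<close>
  have floor: "R (2 * real (nat \<lfloor>\<nu> / 2\<rfloor>))" if \<nu>: "R \<nu>" for \<nu>
  proof -
    obtain v where v: "lin_indep_family i v" "\<forall>j<i. v j \<in> ?\<Gamma> \<and> l1_norm N (v j) \<le> \<nu>"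
      using \<nu> unfolding R_def by blast
    have "l1_norm N (v j) \<le> 2 * real (nat \<lfloor>\<nu> / 2\<rfloor>)" if j: "j < i" for j
    proof -
      have "(\<Sum>k\<le>N. v j k) = 0" using v(2) j by (simp add: toric_module_def)
      then obtain d :: nat where d: "l1_norm N (v j) = 2 * real d"
        using l1_norm_even(1) by blast
      then have "real d \<le> \<nu> / 2" using v(2) j by force
      then have "d \<le> nat \<lfloor>\<nu> / 2\<rfloor>" by (rule le_nat_floor)
      then show ?thesis unfolding d
        by (simp only: mult_le_cancel_left_pos zero_less_numeral of_nat_le_iff)
    qed
    then show ?thesis using v unfolding R_def by blast
  qed
  \<comment> \<open>An admissible bound exists because the module contains \<open>i\<close>
    independent vectors; without one, neither \<open>LEAST\<close> would be meaningful.\<close>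
  obtain v where v: "lin_indep_family i v" "\<forall>j<i. v j \<in> ?\<Gamma>"
    using toric_module_rank[OF assms(3)] by blast
  have "l1_norm N (v j) \<le> (\<Sum>j<i. l1_norm N (v j))" if "j < i" for j
    using that by (intro member_le_sum) (auto simp: l1_norm_def sum_nonneg)
  then have "R (\<Sum>j<i. l1_norm N (v j))" using v unfolding R_def by blast
  then have ex: "\<exists>D. R (2 * real D)" using floor by blast
  define D where "D = (LEAST D. R (2 * real D))"
  have D: "R (2 * real D)" unfolding D_def using ex by (rule LeastI_ex)
  have "(LEAST \<nu>. \<nu> \<ge> 0 \<and> R \<nu>) = 2 * real D"
  proof (rule Least_equality)
    fix \<nu> assume \<nu>: "\<nu> \<ge> 0 \<and> R \<nu>"
    then have "D \<le> nat \<lfloor>\<nu> / 2\<rfloor>" unfolding D_def using floor by (intro Least_le) blast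
    then show "2 * real D \<le> \<nu>" using \<nu> by linarith
  qed (use D in simp)
  then show ?thesis unfolding omega min D_def by simp
qed

end
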